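(* Let $0<d<1/2$ and let $\{Z_n\}_{n\in\mathbb{Z}}$ be a (real-valued) second-order stationary process whose spectral density is $$f(\lambda)=f_d(\lambda)f_0(\lambda),\qquad f_d(\lambda)=\frac{1}{2\pi}\left|1-e^{i\lambda}\right|^{-2d},\quad \lambda\in(-\pi,\pi],$$ where $f_0$ is a spectral density corresponding to the covariance function $\gamma_0(n)=\int_{-\pi}^{\pi}f_0(\lambda)e^{in\lambda}\,d\lambda$. Assume that (a) $\inf_{\lambda\in(-\pi,\pi]}f_0(\lambda)>0$; (b) $\sum_{n=-\infty}^{\infty}|\gamma_0(n)|<\infty$; (c) $\gamma_0(n)=O(n^{-1})$ as $n\to\infty$. Let $\rho_{k,b}$ be the canonical correlation between the blocks $(Z_1,\dots,Z_b)$ and $(Z_{k+1},\dots,Z_{k+b})$. Then for any sequence of positive integers $b_n$ with $b_n=o(n)$, $$\sum_{k=1}^{n}\rho_{k,b_n}=o(n)\quad\text{as }n\to\infty.$$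
   Context: A second-order stationary process $\{Z_n\}$ has covariance function $\gamma(n)=\mathrm{Cov}[Z_n,Z_0]$ and spectral density $f$ if $\gamma(n)=\int_{-\pi}^{\pi}f(\lambda)e^{in\lambda}\,d\lambda$ for all $n\in\mathbb{Z}$. Let $\Sigma_b=(\gamma(i_2-i_1))_{1\le i_1,i_2\le b}$ be the covariance matrix of $(Z_1,\dots,Z_b)$ (assumed non-singular for every $b$) and $\Sigma_{k,b}=(\gamma(i_2+k-i_1))_{1\le i_1,i_2\le b}$ the cross-covariance matrix between $(Z_1,\dots,Z_b)$ and $(Z_{k+1},\dots,Z_{k+b})$. The canonical correlation (defined for all positive integers $k,b$, including overlapping blocks) is $$\rho_{k,b}=\sup_{\mathbf{u},\mathbf{v}\in\mathbb{R}^b}\mathrm{Corr}\Big(\sum_{j=1}^b u_jZ_j,\ \sum_{j=1}^b v_jZ_{k+j}\Big)=\sup_{\mathbf{u},\mathbf{v}\in\mathbb{R}^b}\frac{\mathbf{u}^T\Sigma_{k,b}\mathbf{v}}{\sqrt{\mathbf{u}^T\Sigma_b\mathbf{u}}\sqrt{\mathbf{v}^T\Sigma_b\mathbf{v}}},$$ the supremum being over nonzero $\mathbf{u},\mathbf{v}$. It satisfies $0\le\rho_{k,b}\le1$. *)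

theory Defs
  imports "HOL-Probability.Probability" "HOL-Library.Landau_Symbols"
begin

definition covariance :: "'a measure \<Rightarrow> ('a \<Rightarrow> real) \<Rightarrow> ('a \<Rightarrow> real) \<Rightarrow> real" where
  "covariance M X Y =
     (LINT \<omega>|M. (X \<omega> - (LINT \<xi>|M. X \<xi>)) * (Y \<omega> - (LINT \<xi>|M. Y \<xi>)))"

definition correlation :: "'a measure \<Rightarrow> ('a \<Rightarrow> real) \<Rightarrow> ('a \<Rightarrow> real) \<Rightarrow> real" where
  "correlation M X Y =
     covariance M X Y / (sqrt (covariance M X X) * sqrt (covariance M Y Y))"

definition second_order_stationary :: "'a measure \<Rightarrow> (int \<Rightarrow> 'a \<Rightarrow> real) \<Rightarrow> bool" where
  "second_order_stationary M Z \<longleftrightarrow>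
     prob_space M \<and>
     (\<forall>n. Z n \<in> borel_measurable M) \<and>
     (\<forall>n. integrable M (\<lambda>\<omega>. (Z n \<omega>)\<^sup>2)) \<and>
     (\<forall>n. (LINT \<omega>|M. Z n \<omega>) = (LINT \<omega>|M. Z 0 \<omega>)) \<and>
     (\<forall>m n. covariance M (Z (m + n)) (Z m) = covariance M (Z n) (Z 0))"

definition autocovariance :: "'a measure \<Rightarrow> (int \<Rightarrow> 'a \<Rightarrow> real) \<Rightarrow> int \<Rightarrow> real" where
  "autocovariance M Z n = covariance M (Z n) (Z 0)"

text \<open>Integrability is part of the notion, so that the (complex-valued) integral
  is never the default value of a non-integrable function.\<close>

definition spectral_density :: "(real \<Rightarrow> real) \<Rightarrow> (int \<Rightarrow> real) \<Rightarrow> bool" where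
  "spectral_density f \<gamma> \<longleftrightarrow>
     (\<forall>t\<in>{-pi<..pi}. 0 \<le> f t) \<and>
     set_integrable lborel {-pi<..pi} f \<and>
     (\<forall>n. complex_of_real (\<gamma> n) =
        (LINT t:{-pi<..pi}|lborel. complex_of_real (f t) * exp (\<i> * of_int n * of_real t)))"

text \<open>At \<open>t = 0\<close> the convention \<open>0 powr a = 0\<close> replaces the pole
  by the value \<open>0\<close>; a single point does not affect the integrals.\<close>

definition fd :: "real \<Rightarrow> real \<Rightarrow> real" where
  "fd d t = 1 / (2 * pi) * cmod (1 - exp (\<i> * of_real t)) powr (- 2 * d)"

text \<open>Vectors in \<open>\<real>\<^sup>b\<close> are functions on \<open>nat\<close>, of which only the
  values on \<open>{1..b}\<close> matter. For a second-order process the correlations lie in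
  \<open>[-1, 1]\<close>, so the supremum is a genuine one as soon as \<open>b \<ge> 1\<close>.\<close>

definition canonical_correlation ::
    "'a measure \<Rightarrow> (int \<Rightarrow> 'a \<Rightarrow> real) \<Rightarrow> nat \<Rightarrow> nat \<Rightarrow> real" where
  "canonical_correlation M Z k b =
     (SUP (u, v) \<in> {u. \<exists>j\<in>{1..b}. u j \<noteq> 0} \<times> {v. \<exists>j\<in>{1..b}. v j \<noteq> 0}.
        correlation M (\<lambda>\<omega>. \<Sum>j=1..b. u j * Z (int j) \<omega>)
                      (\<lambda>\<omega>. \<Sum>j=1..b. v j * Z (int (k + j)) \<omega>))"

end

theory Submission
  imports Defs
begin

text \<open>
  Correlations between blocks are quotients of the forms \<open>\<integral> f(t) cnj (U(t)) V(t) cis (k t) dt\<close>, where \<open>U\<close> and \<open>V\<close> are the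
  trigonometric polynomials of the two blocks. For \<open>f = fd d\<close> the covariances are a multiple of the
  Beta integrals \<open>\<integral> x powr (n + d - 1) * (1 - x) powr (- 2 * d) dx\<close> over \<open>[0, 1]\<close>, so the form is the integral of a product of two
  polynomials against such a weight. Each polynomial satisfies
  \<open>\<bar>V(x)\<bar> \<le> C * b powr (1/2 - d) / x ^ b\<close> times the standard deviation of its block, whence the correlation is at most of
  order \<open>(b / k) powr (1 - 2 * d)\<close>, up to a shift of \<open>k\<close> by a multiple of \<open>b\<close>. By uniqueness of Fourier
  coefficients \<open>f0\<close> is almost everywhere a uniform limit of trigonometric polynomials; such a polynomial
  only shifts \<open>k\<close> by a bounded amount, and the uniform error is absorbed by the Cauchy--Schwarz
  inequality because \<open>f0\<close> is bounded below. Hence the canonical correlation tends to \<open>0\<close> uniformly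
  as \<open>k / b\<close> and \<open>k\<close> tend to infinity, and the trivial bound \<open>1\<close> handles the remaining \<open>o(n)\<close> terms.
\<close>

section \<open>Uniqueness of Fourier coefficients\<close>

text \<open>The obstacle is uniformity in \<open>b\<close>: the covariance at lag \<open>k\<close>
  decays like \<open>k powr (2 * d - 1)\<close>, but a correlation divides by standard deviations
  that suitable vectors make small. The Beta integral helps because \<open>x ^ (k + j - i)\<close>
  separates into a factor in \<open>i\<close> and a factor in \<open>j\<close>. Under the integral
  the form is a product of two point evaluations, and the norm of a point evaluation relative to the
  standard deviation can be estimated by duality, for each block on its own and without inverting a
  covariance matrix. The two norms together contribute \<open>b powr (1 - 2 * d)\<close>, which
  cancels against the decay \<open>(m * b) powr (2 * d - 1)\<close> of the covariance at lag
  \<open>m * b\<close> and leaves \<open>m powr (2 * d - 1)\<close>. The density \<open>f0\<close>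
  is given only as an integrable function, so uniqueness of Fourier coefficients is needed in that
  generality. It comes from Stone--Weierstrass and a Dynkin class argument, without summability
  kernels.\<close>

lemma integrable_mult_bounded:
  fixes h g :: "'a \<Rightarrow> real"
  assumes h: "integrable M h" and g: "g \<in> borel_measurable M" and B: "\<And>x. \<bar>g x\<bar> \<le> B"
  shows "integrable M (\<lambda>x. h x * g x)"
proof (rule Bochner_Integration.integrable_bound[of M "\<lambda>x. B * h x"])
  show "integrable M (\<lambda>x. B * h x)" using h by simp
  show "(\<lambda>x. h x * g x) \<in> borel_measurable M" using h g by auto
  show "AE x in M. norm (h x * g x) \<le> norm (B * h x)"
  proof (rule AE_I2)
    fix x
    have "\<bar>h x\<bar> * \<bar>g x\<bar> \<le> \<bar>h x\<bar> * \<bar>B\<bar>"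
      using B[of x] by (intro mult_left_mono) auto
    then show "norm (h x * g x) \<le> norm (B * h x)" by (simp add: abs_mult mult.commute)
  qed
qed

text \<open>All Fourier coefficients of \<open>h * \<phi>\<close> vanish. For fixed \<open>h\<close> these \<open>\<phi>\<close> form a space closed under
  multiplication by \<open>cos\<close> and \<open>sin\<close>, hence by every polynomial in \<open>cis t\<close>.\<close>

definition annihilated :: "(real \<Rightarrow> real) \<Rightarrow> (real \<Rightarrow> real) \<Rightarrow> bool" where
  "annihilated h \<phi> \<longleftrightarrow> \<phi> \<in> borel_measurable borel \<and> (\<exists>B. \<forall>t. \<bar>\<phi> t\<bar> \<le> B) \<and>
     (\<forall>n::int. (LINT t|lborel. h t * (\<phi> t * cos (of_int n * t))) = 0 \<and>
               (LINT t|lborel. h t * (\<phi> t * sin (of_int n * t))) = 0)"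

lemma annihilated_integrable:
  assumes "integrable lborel h" "annihilated h \<phi>" "g \<in> borel_measurable borel" "\<And>t. \<bar>g t\<bar> \<le> 1"
  shows "integrable lborel (\<lambda>t. h t * (\<phi> t * g t))"
proof -
  obtain B where B: "\<And>t. \<bar>\<phi> t\<bar> \<le> B" using assms(2) by (auto simp: annihilated_def)
  have "\<bar>\<phi> t * g t\<bar> \<le> B" for t
    using mult_mono[OF B[of t] assms(4)[of t]] B[of t] by (simp add: abs_mult)
  then show ?thesis
    using assms by (intro integrable_mult_bounded) (auto simp: annihilated_def)
qed

lemma annihilated_add:
  assumes h: "integrable lborel h" and a: "annihilated h \<phi>" "annihilated h \<psi>"
  shows "annihilated h (\<lambda>t. \<phi> t + \<psi> t)"
proof -
  obtain B B' where B: "\<And>t. \<bar>\<phi> t\<bar> \<le> B" "\<And>t. \<bar>\<psi> t\<bar> \<le> B'"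
    using a by (auto simp: annihilated_def)
  have "\<bar>\<phi> t + \<psi> t\<bar> \<le> B + B'" for t using B[of t] by linarith
  moreover have "(LINT t|lborel. h t * ((\<phi> t + \<psi> t) * g t)) =
     (LINT t|lborel. h t * (\<phi> t * g t)) + (LINT t|lborel. h t * (\<psi> t * g t))"
    if "g \<in> borel_measurable borel" "\<And>t. \<bar>g t\<bar> \<le> 1" for g
    using that h a by (simp add: distrib_left distrib_right annihilated_integrable)
  ultimately show ?thesis
    using a unfolding annihilated_def by auto
qed

lemma annihilated_scale:
  assumes a: "annihilated h \<phi>"
  shows "annihilated h (\<lambda>t. c * \<phi> t)"
proof -
  obtain B where B: "\<And>t. \<bar>\<phi> t\<bar> \<le> B" using a by (auto simp: annihilated_def)
  have "\<bar>c * \<phi> t\<bar> \<le> \<bar>c\<bar> * B" for t using B[of t] by (simp add: abs_mult mult_left_mono)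
  moreover have "(LINT t|lborel. h t * (c * \<phi> t * g t)) = c * (LINT t|lborel. h t * (\<phi> t * g t))" for g
    by (subst integral_mult_right_zero[symmetric]) (simp add: mult.left_commute mult.assoc)
  ultimately show ?thesis
    using a unfolding annihilated_def by auto
qed

lemma annihilated_cos_sin:
  assumes h: "integrable lborel h" and a: "annihilated h \<phi>"
  shows "annihilated h (\<lambda>t. cos t * \<phi> t)" "annihilated h (\<lambda>t. sin t * \<phi> t)"
proof -
  obtain B where B: "\<And>t. \<bar>\<phi> t\<bar> \<le> B" using a by (auto simp: annihilated_def)
  have b: "\<bar>cos t * \<phi> t\<bar> \<le> B" "\<bar>sin t * \<phi> t\<bar> \<le> B" for t
    using mult_mono[OF abs_cos_le_one[of t] B[of t]] mult_mono[OF abs_sin_le_one[of t] B[of t]]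
    by (auto simp: abs_mult)
  have m: "\<phi> \<in> borel_measurable borel" using a by (simp add: annihilated_def)
  note z = a[unfolded annihilated_def, THEN conjunct2, THEN conjunct2, rule_format]
  have 1: "(LINT t|lborel. h t * (cos t * \<phi> t * cos (of_int n * t))) = 0" for n :: int
  proof -
    have "(LINT t|lborel. h t * (cos t * \<phi> t * cos (of_int n * t))) =
      (LINT t|lborel. 1/2 * (h t * (\<phi> t * cos (of_int (n+1) * t)) + h t * (\<phi> t * cos (of_int (n-1) * t))))"
      by (intro Bochner_Integration.integral_cong refl)
         (simp add: distrib_left distrib_right left_diff_distrib cos_add cos_diff algebra_simps)
    also have "\<dots> = 0"
      by (subst integral_mult_right_zero, subst Bochner_Integration.integral_add)
         (use h a z[of "n+1"] z[of "n-1"] in \<open>auto intro!: annihilated_integrable\<close>)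
    finally show ?thesis .
  qed
  have 2: "(LINT t|lborel. h t * (cos t * \<phi> t * sin (of_int n * t))) = 0" for n :: int
  proof -
    have "(LINT t|lborel. h t * (cos t * \<phi> t * sin (of_int n * t))) =
      (LINT t|lborel. 1/2 * (h t * (\<phi> t * sin (of_int (n+1) * t)) + h t * (\<phi> t * sin (of_int (n-1) * t))))"
      by (intro Bochner_Integration.integral_cong refl)
         (simp add: distrib_left distrib_right left_diff_distrib sin_add sin_diff algebra_simps)
    also have "\<dots> = 0"
      by (subst integral_mult_right_zero, subst Bochner_Integration.integral_add)
         (use h a z[of "n+1"] z[of "n-1"] in \<open>auto intro!: annihilated_integrable\<close>)
    finally show ?thesis .
  qed
  have 3: "(LINT t|lborel. h t * (sin t * \<phi> t * cos (of_int n * t))) = 0" for n :: int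
  proof -
    have "(LINT t|lborel. h t * (sin t * \<phi> t * cos (of_int n * t))) =
      (LINT t|lborel. 1/2 * (h t * (\<phi> t * sin (of_int (n+1) * t)) - h t * (\<phi> t * sin (of_int (n-1) * t))))"
      by (intro Bochner_Integration.integral_cong refl)
         (simp add: distrib_left distrib_right left_diff_distrib sin_add sin_diff algebra_simps)
    also have "\<dots> = 0"
      by (subst integral_mult_right_zero, subst Bochner_Integration.integral_diff)
         (use h a z[of "n+1"] z[of "n-1"] in \<open>auto intro!: annihilated_integrable\<close>)
    finally show ?thesis .
  qed
  have 4: "(LINT t|lborel. h t * (sin t * \<phi> t * sin (of_int n * t))) = 0" for n :: int
  proof -
    have "(LINT t|lborel. h t * (sin t * \<phi> t * sin (of_int n * t))) =
      (LINT t|lborel. 1/2 * (h t * (\<phi> t * cos (of_int (n-1) * t)) - h t * (\<phi> t * cos (of_int (n+1) * t))))"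
      by (intro Bochner_Integration.integral_cong refl)
         (simp add: distrib_left distrib_right left_diff_distrib cos_add cos_diff algebra_simps)
    also have "\<dots> = 0"
      by (subst integral_mult_right_zero, subst Bochner_Integration.integral_diff)
         (use h a z[of "n+1"] z[of "n-1"] in \<open>auto intro!: annihilated_integrable\<close>)
    finally show ?thesis .
  qed
  show "annihilated h (\<lambda>t. cos t * \<phi> t)" "annihilated h (\<lambda>t. sin t * \<phi> t)"
    unfolding annihilated_def using 1 2 3 4 b m by auto
qed

lemma annihilated_polynomial:
  fixes p :: "complex \<Rightarrow> real"
  assumes p: "real_polynomial_function p" and h: "integrable lborel h" and a: "annihilated h \<phi>"
  shows "annihilated h (\<lambda>t. p (cis t) * \<phi> t)"
  using p a
proof (induction arbitrary: \<phi> rule: real_polynomial_function.induct)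
  case (linear f)
  have "f (cis t) * \<phi> t = f 1 * (cos t * \<phi> t) + f \<i> * (sin t * \<phi> t)" for t
  proof -
    have "cis t = cos t *\<^sub>R 1 + sin t *\<^sub>R \<i>" by (simp add: complex_eq_iff)
    then have "f (cis t) = cos t * f 1 + sin t * f \<i>"
      using linear_add[OF bounded_linear.linear[OF linear(1)], of "cos t *\<^sub>R 1" "sin t *\<^sub>R \<i>"]
        linear_cmul[OF bounded_linear.linear[OF linear(1)]] by simp
    then show ?thesis by (simp add: algebra_simps)
  qed
  then show ?case
    using annihilated_add[OF h annihilated_scale annihilated_scale] annihilated_cos_sin[OF h] linear(2)
    by presburger
next
  case (const c) then show ?case by (rule annihilated_scale)
next
  case (add f g)
  then show ?case using annihilated_add[OF h] by (simp add: distrib_right)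
next
  case (mult f g)
  then show ?case by (simp add: mult.assoc)
qed

text \<open>By \<open>annihilated_polynomial\<close>, \<open>h\<close> integrates to 0 against every
  real polynomial in \<open>cis t\<close>. Stone--Weierstrass on the unit circle passes to
  continuous functions, a uniform error \<open>e\<close> costing at most \<open>e\<close> times the
  integral of \<open>\<bar>h\<bar>\<close>; dominated convergence then passes to indicators of open
  sets.\<close>

lemma integral_open_zero:
  fixes U :: "complex set"
  assumes h: "integrable lborel h" and a: "annihilated h (\<lambda>_. 1)" and U: "open U"
  shows "(LINT t|lborel. h t * indicator U (cis t)) = 0"
proof -
  have m: "(\<lambda>t. cis t) \<in> borel_measurable borel"
    by (intro borel_measurable_continuous_onI continuous_intros)
  have cont0: "(LINT t|lborel. h t * g (cis t)) = 0"
    if g: "continuous_on UNIV g" and gb: "\<And>z. \<bar>g z\<bar> \<le> 1" for g :: "complex \<Rightarrow> real"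
  proof -
    have gm: "(\<lambda>t. g (cis t)) \<in> borel_measurable borel"
      using g m by (rule borel_measurable_continuous_on)
    have "\<bar>LINT t|lborel. h t * g (cis t)\<bar> \<le> e * (LINT t|lborel. \<bar>h t\<bar>)" if e: "e > 0" for e
    proof -
      obtain p where p: "real_polynomial_function p"
        and pe: "\<And>z. z \<in> sphere 0 1 \<Longrightarrow> \<bar>g z - p z\<bar> < e"
        using Stone_Weierstrass_real_polynomial_function[of "sphere (0::complex) 1" g e] e
          continuous_on_subset[OF g] by auto
      have ap: "annihilated h (\<lambda>t. p (cis t) * 1)" by (rule annihilated_polynomial[OF p h a])
      have ip: "integrable lborel (\<lambda>t. h t * p (cis t))"
        using annihilated_integrable[OF h ap, of "\<lambda>_. 1"] by simp
      have zp: "(LINT t|lborel. h t * p (cis t)) = 0"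
        using ap[unfolded annihilated_def, THEN conjunct2, THEN conjunct2, rule_format, of 0] by simp
      have ig: "integrable lborel (\<lambda>t. h t * g (cis t))"
        using h gm gb by (intro integrable_mult_bounded[where B=1]) auto
      have "(LINT t|lborel. h t * g (cis t)) = (LINT t|lborel. h t * g (cis t) - h t * p (cis t))"
        using ip ig zp by simp
      also have "\<bar>\<dots>\<bar> \<le> (LINT t|lborel. \<bar>h t * g (cis t) - h t * p (cis t)\<bar>)"
        by simp
      also have "\<dots> \<le> (LINT t|lborel. e * \<bar>h t\<bar>)"
      proof (rule integral_mono)
        show "integrable lborel (\<lambda>t. \<bar>h t * g (cis t) - h t * p (cis t)\<bar>)" using ip ig by simp
        show "integrable lborel (\<lambda>t. e * \<bar>h t\<bar>)" using h by simp
        fix t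
        have "\<bar>h t * g (cis t) - h t * p (cis t)\<bar> = \<bar>g (cis t) - p (cis t)\<bar> * \<bar>h t\<bar>"
          by (simp add: abs_mult[symmetric] algebra_simps)
        also have "\<dots> \<le> e * \<bar>h t\<bar>" using pe[of "cis t"] by (intro mult_right_mono) auto
        finally show "\<bar>h t * g (cis t) - h t * p (cis t)\<bar> \<le> e * \<bar>h t\<bar>" .
      qed
      finally show ?thesis by simp
    qed
    then have "\<bar>LINT t|lborel. h t * g (cis t)\<bar> \<le> 0"
    proof (intro tendsto_lowerbound[of "\<lambda>e. e * (LINT t|lborel. \<bar>h t\<bar>)" 0 "at_right 0"])
      show "((\<lambda>e. e * (LINT t|lborel. \<bar>h t\<bar>)) \<longlongrightarrow> 0) (at_right 0)"
        by (auto intro!: tendsto_eq_intros)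
    qed (auto simp: eventually_at_right_less intro: eventually_mono[OF eventually_at_right_less])
    then show ?thesis by simp
  qed
  show ?thesis
  proof (cases "U = UNIV")
    case True then show ?thesis using cont0[of "\<lambda>_. 1"] by simp
  next
    case False
    \<comment> \<open>These increase to the indicator of \<open>U\<close>. The case
      \<open>U = UNIV\<close> had to be split off because \<open>infdist\<close> to the empty set is
      0.\<close>
    define g where "g n z = min 1 (real n * infdist z (- U))" for n z
    have g0: "0 \<le> g n z" "g n z \<le> 1" for n z by (auto simp: g_def infdist_nonneg)
    have z: "(LINT t|lborel. h t * g n (cis t)) = 0" for n
      using g0 by (intro cont0) (auto simp: g_def intro!: continuous_intros)
    have lim: "(\<lambda>n. g n z) \<longlonglongrightarrow> indicator U z" for z
    proof (cases "z \<in> U")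
      case True
      have pos: "infdist z (-U) > 0"
        using infdist_pos_not_in_closed[of "-U" z] U False True by (auto simp: closed_def)
      obtain N where N: "real N * infdist z (-U) > 1" using ex_less_of_nat_mult[OF pos] by blast
      have "g n z = 1" if "n \<ge> N" for n
      proof -
        have "real N * infdist z (-U) \<le> real n * infdist z (-U)"
          using that pos by (intro mult_right_mono) auto
        then show ?thesis using N by (simp add: g_def)
      qed
      then show ?thesis using True
        by (intro tendsto_eventually) (auto simp: eventually_sequentially)
    next
      case False then show ?thesis by (simp add: g_def)
    qed
    have "(\<lambda>n. LINT t|lborel. h t * g n (cis t)) \<longlonglongrightarrow> (LINT t|lborel. h t * indicator U (cis t))"
    proof (rule integral_dominated_convergence[where w="\<lambda>t. \<bar>h t\<bar>"])
      show "(\<lambda>t. h t * g n (cis t)) \<in> borel_measurable lborel" for n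
      proof -
        have "(\<lambda>t. g n (cis t)) \<in> borel_measurable borel"
          unfolding g_def by (intro borel_measurable_continuous_onI continuous_intros)
        then show ?thesis using h by auto
      qed
      show "(\<lambda>t. h t * indicator U (cis t)) \<in> borel_measurable lborel"
      proof -
        have [measurable]: "U \<in> sets borel" using U by auto
        show ?thesis using h m by measurable
      qed
      show "AE t in lborel. (\<lambda>n. h t * g n (cis t)) \<longlonglongrightarrow> h t * indicator U (cis t)"
        by (auto intro!: tendsto_intros lim)
      show "AE t in lborel. norm (h t * g n (cis t)) \<le> \<bar>h t\<bar>" for n
        using g0 by (auto simp: abs_mult intro!: mult_left_le)
    qed (use h in auto)
    then show ?thesis using z by (simp add: LIMSEQ_const_iff)
  qed
qed

text \<open>Open sets are an intersection-stable generator of the Borel sets. The sets with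
  vanishing integral are closed under complements, because the total integral is 0, and under
  countable disjoint unions, by dominated convergence.\<close>

lemma integral_borel_zero:
  fixes A :: "complex set"
  assumes h: "integrable lborel h" and a: "annihilated h (\<lambda>_. 1)" and A: "A \<in> sets borel"
  shows "(LINT t|lborel. h t * indicator A (cis t)) = 0"
proof -
  have m[measurable]: "(\<lambda>t. cis t) \<in> borel_measurable borel"
    by (intro borel_measurable_continuous_onI continuous_intros)
  have i: "integrable lborel (\<lambda>t. h t * indicator A (cis t))" if "A \<in> sets borel" for A
    using h that by (intro integrable_mult_bounded[where B=1]) (auto simp: indicator_def)
  have h0: "(LINT t|lborel. h t) = 0" using integral_open_zero[OF h a open_UNIV] by simp
  have "Int_stable {S::complex set. open S}" by (auto simp: Int_stable_def)
  moreover have "{S::complex set. open S} \<subseteq> Pow UNIV" by auto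
  moreover have "A \<in> sigma_sets UNIV {S. open S}" using A by (simp add: borel_def)
  ultimately show ?thesis
  proof (induction rule: sigma_sets_induct_disjoint)
    case (basic A) then show ?case using integral_open_zero[OF h a] by auto
  next
    case empty then show ?case by simp
  next
    case (compl A)
    then have "A \<in> sets borel" by (simp add: borel_def)
    have "(LINT t|lborel. h t * indicator (UNIV - A) (cis t)) = (LINT t|lborel. h t - h t * indicator A (cis t))"
      by (intro Bochner_Integration.integral_cong) (auto simp: indicator_def)
    then show ?case using compl h i[OF \<open>A \<in> sets borel\<close>] h0 by simp
  next
    case (union A)
    then have A: "A k \<in> sets borel" for k by (auto simp: borel_def)
    have "(\<lambda>n. LINT t|lborel. h t * indicator (\<Union>k<n. A k) (cis t)) \<longlonglongrightarrow> (LINT t|lborel. h t * indicator (\<Union>k. A k) (cis t))"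
    proof (rule integral_dominated_convergence[where w="\<lambda>t. \<bar>h t\<bar>"])
      have "(\<Union>k<n. A k) \<in> sets borel" for n using A by auto
      then show "(\<lambda>t. h t * indicator (\<Union>k<n. A k) (cis t)) \<in> borel_measurable lborel" for n
        using h by measurable
      have "(\<Union>k. A k) \<in> sets borel" using A by auto
      then show "(\<lambda>t. h t * indicator (\<Union>k. A k) (cis t)) \<in> borel_measurable lborel"
        using h by measurable
      show "AE t in lborel. (\<lambda>n. h t * indicator (\<Union>k<n. A k) (cis t)) \<longlonglongrightarrow> h t * indicator (\<Union>k. A k) (cis t)"
      proof (intro AE_I2 tendsto_intros)
        fix t
        show "(\<lambda>n. indicator (\<Union>k<n. A k) (cis t) :: real) \<longlonglongrightarrow> indicator (\<Union>k. A k) (cis t)"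
          by (rule LIMSEQ_indicator_UN)
      qed
      show "AE t in lborel. norm (h t * indicator (\<Union>k<n. A k) (cis t)) \<le> \<bar>h t\<bar>" for n
        by (auto simp: indicator_def)
    qed (use h in auto)
    moreover have "(LINT t|lborel. h t * indicator (\<Union>k<n. A k) (cis t)) = 0" for n
    proof -
      have "indicator (\<Union>k<n. A k) z = (\<Sum>k<n. indicator (A k) z :: real)" for z
        using union(1) by (subst indicator_UN_disjoint) (auto simp: disjoint_family_on_def)
      then have "(LINT t|lborel. h t * indicator (\<Union>k<n. A k) (cis t)) =
          (LINT t|lborel. (\<Sum>k<n. h t * indicator (A k) (cis t)))"
        by (intro Bochner_Integration.integral_cong refl) (simp only: sum_distrib_left)
      also have "\<dots> = (\<Sum>k<n. LINT t|lborel. h t * indicator (A k) (cis t))"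
        using i[OF A] by (intro Bochner_Integration.integral_sum) auto
      finally have "(LINT t|lborel. h t * indicator (\<Union>k<n. A k) (cis t)) =
          (\<Sum>k<n. LINT t|lborel. h t * indicator (A k) (cis t))" .
      then show ?thesis using union by simp
    qed
    ultimately show ?case by (simp add: LIMSEQ_const_iff)
  qed
qed

text \<open>Test \<open>h\<close> on the set where it is positive. Since \<open>cis\<close> is
  injective on one period, that set is, up to a null set, the part in the period of the preimage of
  a Borel set \<open>A\<close> of the plane; hence the positive part of \<open>h\<close> has
  integral 0.\<close>

lemma fourier_nonpos:
  assumes h: "integrable lborel h" and s: "\<And>t. t \<notin> {-pi<..pi} \<Longrightarrow> h t = 0"
    and a: "annihilated h (\<lambda>_. 1)"
  shows "AE t in lborel. h t \<le> 0"
proof -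
  have c: "continuous_on (- \<real>\<^sub>\<le>\<^sub>0) Arg" by (rule continuous_on_Arg)
  have [measurable]: "- \<real>\<^sub>\<le>\<^sub>0 \<in> sets (borel :: complex measure)" by (intro borel_open) auto
  \<comment> \<open>A Borel left inverse of \<open>cis\<close> on the open period. Cutting off the
    nonpositive reals, where \<open>Arg\<close> is not continuous, loses only the point
    \<open>pi\<close>.\<close>
  define g where "g = (\<lambda>z. indicator (- \<real>\<^sub>\<le>\<^sub>0) z *\<^sub>R Arg z)"
  have [measurable]: "g \<in> borel_measurable borel"
    unfolding g_def by (rule borel_measurable_continuous_on_indicator[OF _ c]) measurable
  have [measurable]: "h \<in> borel_measurable borel" using h by simp
  define A where "A = {z. h (g z) > 0}"
  have A: "A \<in> sets borel" unfolding A_def by measurable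
  have gc: "g (cis t) = t" if "-pi < t" "t < pi" for t
  proof -
    have "Arg (cis t) = t" using that by (intro cis_Arg_unique) (auto simp: sgn_div_norm)
    moreover have "cis t \<notin> \<real>\<^sub>\<le>\<^sub>0"
    proof
      assume "cis t \<in> \<real>\<^sub>\<le>\<^sub>0"
      then have "Im (cis t) = 0" "Re (cis t) \<le> 0" by (auto simp: complex_nonpos_Reals_iff)
      then have st: "sin t = 0" "cos t \<le> 0" by auto
      have "t = 0" using sin_zero_pi_iff[of t] that st by auto
      then show False using st by simp
    qed
    ultimately show ?thesis by (simp add: g_def)
  qed
  have "AE t in lborel. t \<noteq> pi" by (rule AE_lborel_singleton)
  then have eq: "AE t in lborel. h t * indicator A (cis t) = max 0 (h t)"
  proof eventually_elim
    case (elim t)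
    show ?case
    proof (cases "t \<in> {-pi<..pi}")
      case True then show ?thesis using elim gc[of t] by (auto simp: A_def indicator_def)
    next
      case False then show ?thesis using s by simp
    qed
  qed
  have m[measurable]: "cis \<in> borel_measurable borel"
    by (intro borel_measurable_continuous_onI continuous_intros)
  have "(\<lambda>t. indicator A (cis t) :: real) \<in> borel_measurable borel"
    using A by measurable
  then have [measurable]: "(\<lambda>t. h t * indicator A (cis t)) \<in> borel_measurable lborel"
    by auto
  have "(LINT t|lborel. max 0 (h t)) = (LINT t|lborel. h t * indicator A (cis t))"
    using eq by (intro integral_cong_AE) auto
  also have "\<dots> = 0" by (rule integral_borel_zero[OF h a A])
  finally have "AE t in lborel. max 0 (h t) = 0"
    using h integral_nonneg_eq_0_iff_AE[of lborel "\<lambda>t. max 0 (h t)"] by auto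
  then show ?thesis by eventually_elim auto
qed

lemma fourier_uniqueness:
  fixes h :: "real \<Rightarrow> real"
  assumes h: "integrable lborel h" and s: "\<And>t. t \<notin> {-pi<..pi} \<Longrightarrow> h t = 0"
    and c: "\<And>n::int. (LINT t|lborel. h t * cos (of_int n * t)) = 0"
           "\<And>n::int. (LINT t|lborel. h t * sin (of_int n * t)) = 0"
  shows "AE t in lborel. h t = 0"
proof -
  have "AE t in lborel. h t \<le> 0"
    by (rule fourier_nonpos[OF h s]) (use c in \<open>auto simp: annihilated_def intro: exI[of _ 1]\<close>)
  moreover have "AE t in lborel. - h t \<le> 0"
    by (rule fourier_nonpos) (use h s c in \<open>auto simp: annihilated_def intro: exI[of _ 1]\<close>)
  ultimately show ?thesis by eventually_elim auto
qed

section \<open>Uniform trigonometric approximation of the spectral density\<close>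

abbreviation circle :: "real \<Rightarrow> real" where
  "circle \<equiv> indicator {-pi<..pi}"

lemma integrable_circle: "integrable lborel circle"
  by (intro integrable_real_indicator) auto

lemma integral_circle_cos:
  "(LINT t|lborel. circle t * cos (of_int a * t)) = (if a = 0 then 2 * pi else 0)"
proof (cases "a = 0")
  case True
  then show ?thesis by simp
next
  case False
  have "AE t in lborel. t \<noteq> - pi" by (rule AE_lborel_singleton)
  then have "(LINT t|lborel. circle t * cos (of_int a * t)) =
      (LINT t|lborel. cos (of_int a * t) * indicator {-pi..pi} t)"
    by (intro integral_cong_AE) (auto elim!: eventually_mono simp: indicator_def)
  also have "\<dots> = sin (of_int a * pi) / of_int a - sin (of_int a * (-pi)) / of_int a"
    using False
    by (intro integral_FTC_Icc_real) (auto intro!: derivative_eq_intros continuous_intros)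
  also have "\<dots> = 0" by (simp add: sin_integer_2pi mult.commute[of _ pi] sin_npi_int)
  finally show ?thesis using False by simp
qed

lemma integral_circle_sin: "(LINT t|lborel. circle t * sin (of_int a * t)) = 0"
proof (cases "a = 0")
  case False
  have "AE t in lborel. t \<noteq> - pi" by (rule AE_lborel_singleton)
  then have "(LINT t|lborel. circle t * sin (of_int a * t)) =
      (LINT t|lborel. sin (of_int a * t) * indicator {-pi..pi} t)"
    by (intro integral_cong_AE) (auto elim!: eventually_mono simp: indicator_def)
  also have "\<dots> = - cos (of_int a * pi) / of_int a - - cos (of_int a * (-pi)) / of_int a"
    using False
    by (intro integral_FTC_Icc_real) (auto intro!: derivative_eq_intros continuous_intros)
  also have "\<dots> = 0" by simp
  finally show ?thesis .
qed simp

lemma spectral_densityD: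
  assumes "spectral_density f \<gamma>"
  shows "integrable lborel (\<lambda>t. circle t * f t)"
    and "\<gamma> n = (LINT t|lborel. circle t * f t * cos (of_int n * t))"
    and "(LINT t|lborel. circle t * f t * sin (of_int n * t)) = 0"
    and "t \<in> {-pi<..pi} \<Longrightarrow> 0 \<le> f t"
proof -
  show i: "integrable lborel (\<lambda>t. circle t * f t)"
    using assms by (simp add: spectral_density_def set_integrable_def)
  show "t \<in> {-pi<..pi} \<Longrightarrow> 0 \<le> f t"
    using assms by (simp add: spectral_density_def)
  let ?E = "\<lambda>t. complex_of_real (circle t * f t) * cis (of_int n * t)"
  have E: "complex_of_real (\<gamma> n) = (LINT t|lborel. ?E t)"
    using assms
    by (auto simp: spectral_density_def set_lebesgue_integral_def cis_conv_exp scaleR_conv_of_real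
        mult_ac intro!: Bochner_Integration.integral_cong)
  have "integrable lborel ?E"
  proof (rule Bochner_Integration.integrable_bound[OF i])
    have "(\<lambda>t. cis (of_int n * t)) \<in> borel_measurable lborel"
      by (subst measurable_lborel2) (intro borel_measurable_continuous_onI continuous_intros)
    then show "?E \<in> borel_measurable lborel"
      by (rule borel_measurable_times[OF measurable_compose[OF borel_measurable_integrable[OF i] borel_measurable_of_real]])
  qed (simp add: norm_mult)
  from integral_Re[OF this] integral_Im[OF this] E[symmetric]
  show "\<gamma> n = (LINT t|lborel. circle t * f t * cos (of_int n * t))"
    "(LINT t|lborel. circle t * f t * sin (of_int n * t)) = 0"
    by simp_all
qed

lemma spectral_density_even: "spectral_density f \<gamma> \<Longrightarrow> \<gamma> (- n) = \<gamma> n"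
  by (simp add: spectral_densityD(2))

text \<open>The cosine series with the coefficients of \<open>f\<close> converges absolutely and
  uniformly to some \<open>F\<close>. Integrating term by term, \<open>F\<close> and
  \<open>f\<close> have the same Fourier coefficients, so they agree almost everywhere, and a
  partial sum with small tail does the job.\<close>

lemma spectral_density_uniform_approx:
  assumes sd: "spectral_density f \<gamma>" and sum: "(\<lambda>n. \<bar>\<gamma> n\<bar>) summable_on UNIV" and "e > 0"
  shows "\<exists>N c. AE t in lborel. t \<in> {-pi<..pi} \<longrightarrow> \<bar>f t - (\<Sum>m<N. c m * cos (real m * t))\<bar> \<le> e"
proof -
  have "(\<lambda>n. \<bar>\<gamma> n\<bar>) summable_on range int"
    using sum by (rule summable_on_subset_banach) simp
  then have s0: "summable (\<lambda>m. \<bar>\<gamma> (int m)\<bar>)"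
    by (subst (asm) summable_on_reindex) (auto simp: o_def summable_on_UNIV_nonneg_real_iff inj_on_def)
  \<comment> \<open>The covariances are Fourier integrals without normalisation, whence the division
    by \<open>2 * pi\<close>; the frequencies \<open>m\<close> and \<open>- m\<close> are merged
    into one cosine, whence the 2.\<close>
  define c where "c m = (if m = 0 then 1 else 2) * \<gamma> (int m) / (2 * pi)" for m :: nat
  have cle: "\<bar>c m\<bar> \<le> \<bar>\<gamma> (int m)\<bar>" for m
  proof -
    have "2 * \<bar>\<gamma> (int m)\<bar> \<le> 2 * pi * \<bar>\<gamma> (int m)\<bar>" using pi_ge_two by (intro mult_right_mono) auto
    moreover have "\<bar>\<gamma> (int m)\<bar> \<le> 2 * \<bar>\<gamma> (int m)\<bar>" by simp
    ultimately show ?thesis by (auto simp: c_def abs_mult field_simps)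
  qed
  have sc: "summable (\<lambda>m. \<bar>c m\<bar>)" by (rule summable_comparison_test[OF _ s0]) (use cle in auto)
  have st: "summable (\<lambda>m. \<bar>c m * cos (real m * t)\<bar>)" for t
    by (rule summable_comparison_test[OF _ sc]) (auto simp: abs_mult mult_left_le)
  define F where "F t = (\<Sum>m. c m * cos (real m * t))" for t
  have [measurable]: "F \<in> borel_measurable borel" unfolding F_def by measurable
  have intF: "(LINT t|lborel. circle t * F t * g t) = (\<Sum>m. LINT t|lborel. circle t * (c m * cos (real m * t)) * g t)"
    "integrable lborel (\<lambda>t. circle t * F t * g t)"
    if g[measurable]: "g \<in> borel_measurable borel" and gb: "\<And>t. \<bar>g t\<bar> \<le> 1" for g
  proof -
    have eq: "circle t * F t * g t = (\<Sum>m. circle t * (c m * cos (real m * t)) * g t)" for t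
      unfolding F_def using summable_rabs_cancel[OF st, of t]
      by (intro sums_unique sums_mult sums_mult2 summable_sums)
    have bd: "\<bar>circle t * (c m * cos (real m * t)) * g t\<bar> \<le> circle t * \<bar>c m\<bar>" for t m
    proof -
      have "\<bar>c m * cos (real m * t)\<bar> * \<bar>g t\<bar> \<le> \<bar>c m\<bar> * 1"
        by (intro mult_mono gb) (auto simp: abs_mult mult_left_le)
      then show ?thesis by (auto simp: abs_mult indicator_def)
    qed
    have i: "integrable lborel (\<lambda>t. circle t * (c m * cos (real m * t)) * g t)" for m
      by (rule Bochner_Integration.integrable_bound[of _ "\<lambda>t. circle t * \<bar>c m\<bar>"])
         (use integrable_circle bd in auto)
    have s: "summable (\<lambda>m. \<bar>circle t * (c m * cos (real m * t)) * g t\<bar>)" for t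
      by (rule summable_comparison_test[OF _ sc]) (use bd[of t] in \<open>auto simp: indicator_def\<close>)
    have "(LINT t|lborel. \<bar>circle t * (c m * cos (real m * t)) * g t\<bar>) \<le> 2 * pi * \<bar>c m\<bar>" for m
    proof -
      have "(LINT t|lborel. \<bar>circle t * (c m * cos (real m * t)) * g t\<bar>) \<le> (LINT t|lborel. circle t * \<bar>c m\<bar>)"
        by (intro integral_mono integrable_abs i bd) (use integrable_circle in auto)
      then show ?thesis by simp
    qed
    then have ss: "summable (\<lambda>m. LINT t|lborel. \<bar>circle t * (c m * cos (real m * t)) * g t\<bar>)"
      by (intro summable_comparison_test[OF _ summable_mult[OF sc, of "2 * pi"]]) auto
    show "(LINT t|lborel. circle t * F t * g t) = (\<Sum>m. LINT t|lborel. circle t * (c m * cos (real m * t)) * g t)"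
      unfolding eq by (rule integral_suminf[OF i]) (use s ss in auto)
    show "integrable lborel (\<lambda>t. circle t * F t * g t)"
      unfolding eq by (rule integrable_suminf[OF i]) (use s ss in auto)
  qed
  have cc: "(LINT t|lborel. circle t * (c m * cos (real m * t)) * cos (of_int n * t)) =
      c m / 2 * ((if int m + n = 0 then 2 * pi else 0) + (if int m - n = 0 then 2 * pi else 0))" for m n
  proof -
    have "(LINT t|lborel. circle t * (c m * cos (real m * t)) * cos (of_int n * t)) =
      (LINT t|lborel. c m / 2 * (circle t * cos (of_int (int m + n) * t) + circle t * cos (of_int (int m - n) * t)))"
      by (intro Bochner_Integration.integral_cong refl) (simp add: algebra_simps cos_add cos_diff)
    also have "\<dots> = c m / 2 * ((LINT t|lborel. circle t * cos (of_int (int m + n) * t)) +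
         (LINT t|lborel. circle t * cos (of_int (int m - n) * t)))"
      by (subst integral_mult_right_zero, subst Bochner_Integration.integral_add)
         (auto intro!: integrable_mult_bounded[where B=1] integrable_circle)
    finally show ?thesis unfolding integral_circle_cos .
  qed
  have cs: "(LINT t|lborel. circle t * (c m * cos (real m * t)) * sin (of_int n * t)) = 0" for m n
  proof -
    have "(LINT t|lborel. circle t * (c m * cos (real m * t)) * sin (of_int n * t)) =
      (LINT t|lborel. c m / 2 * (circle t * sin (of_int (n + int m) * t) + circle t * sin (of_int (n - int m) * t)))"
      by (intro Bochner_Integration.integral_cong refl) (simp add: algebra_simps sin_add sin_diff)
    also have "\<dots> = c m / 2 * ((LINT t|lborel. circle t * sin (of_int (n + int m) * t)) +
         (LINT t|lborel. circle t * sin (of_int (n - int m) * t)))"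
      by (subst integral_mult_right_zero, subst Bochner_Integration.integral_add)
         (auto intro!: integrable_mult_bounded[where B=1] integrable_circle)
    finally show ?thesis unfolding integral_circle_sin by simp
  qed
  have Fcos: "(LINT t|lborel. circle t * F t * cos (of_int n * t)) = \<gamma> n" for n
  proof -
    have "(LINT t|lborel. circle t * F t * cos (of_int n * t)) =
       (\<Sum>m. c m / 2 * ((if int m + n = 0 then 2 * pi else 0) + (if int m - n = 0 then 2 * pi else 0)))"
      by (subst intF) (auto simp: cc)
    \<comment> \<open>Only \<open>m = \<bar>n\<bar>\<close> contributes. For \<open>n = 0\<close>
      both conditions hold at once, which makes up for the missing factor 2 in
      \<open>c 0\<close>.\<close>
    also have "\<dots> = (\<Sum>m\<in>{nat \<bar>n\<bar>}. c m / 2 * ((if int m + n = 0 then 2 * pi else 0) + (if int m - n = 0 then 2 * pi else 0)))"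
      by (rule suminf_finite) auto
    also have "\<dots> = \<gamma> n"
      using spectral_density_even[OF sd, of n] by (auto simp: c_def split: if_splits)
    finally show ?thesis .
  qed
  have Fsin: "(LINT t|lborel. circle t * F t * sin (of_int n * t)) = 0" for n
    by (subst intF) (auto simp: cs)
  have "AE t in lborel. circle t * f t - circle t * F t = 0"
  proof (rule fourier_uniqueness)
    have iF: "integrable lborel (\<lambda>t. circle t * F t)" using intF(2)[of "\<lambda>_. 1"] by simp
    show "integrable lborel (\<lambda>t. circle t * f t - circle t * F t)"
      using iF spectral_densityD(1)[OF sd] by simp
    have 1: "integrable lborel (\<lambda>t. circle t * f t * g t)" "integrable lborel (\<lambda>t. circle t * F t * g t)"
      if "g \<in> borel_measurable borel" "\<And>t. \<bar>g t\<bar> \<le> 1" for g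
      using that iF spectral_densityD(1)[OF sd] by (auto intro!: integrable_mult_bounded)
    show "(LINT t|lborel. (circle t * f t - circle t * F t) * cos (of_int n * t)) = 0" for n :: int
      using 1[of "\<lambda>t. cos (of_int n * t)"] Fcos[of n] spectral_densityD(2)[OF sd, of n]
      by (simp add: left_diff_distrib)
    show "(LINT t|lborel. (circle t * f t - circle t * F t) * sin (of_int n * t)) = 0" for n :: int
      using 1[of "\<lambda>t. sin (of_int n * t)"] Fsin[of n] spectral_densityD(3)[OF sd, of n]
      by (simp add: left_diff_distrib)
  qed auto
  then have ae: "AE t in lborel. t \<in> {-pi<..pi} \<longrightarrow> f t = F t"
    by eventually_elim auto
  obtain N where N: "\<bar>\<Sum>m. \<bar>c (m + N)\<bar>\<bar> < e"
    using suminf_exist_split[OF \<open>e > 0\<close> sc] by force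
  have "\<bar>F t - (\<Sum>m<N. c m * cos (real m * t))\<bar> \<le> e" for t
  proof -
    have "F t - (\<Sum>m<N. c m * cos (real m * t)) = (\<Sum>m. c (m + N) * cos (real (m + N) * t))"
      unfolding F_def using suminf_minus_initial_segment[OF summable_rabs_cancel[OF st, of t], of N] by simp
    also have "\<bar>\<dots>\<bar> \<le> (\<Sum>m. \<bar>c (m + N) * cos (real (m + N) * t)\<bar>)"
      using summable_ignore_initial_segment[OF st[of t], of N] by (intro summable_rabs) auto
    also have "\<dots> \<le> (\<Sum>m. \<bar>c (m + N)\<bar>)"
      using summable_ignore_initial_segment[OF st[of t], of N] summable_ignore_initial_segment[OF sc, of N]
      by (intro suminf_le) (auto simp: abs_mult mult_left_le)
    also have "\<dots> \<le> e" using N by simp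
    finally show ?thesis .
  qed
  with ae show ?thesis
    by (intro exI[of _ N] exI[of _ c]) (auto elim!: eventually_mono)
qed

section \<open>The covariances of fractional noise\<close>

lemma fd_eq: "fd d t = (2 - 2 * cos t) powr (- d) / (2 * pi)"
proof -
  have 1: "cmod (1 - exp (\<i> * of_real t)) = 2 * \<bar>sin (t / 2)\<bar>"
    using dist_exp_i_1[of t] by (simp add: norm_minus_commute)
  have 2: "(2 * \<bar>sin (t / 2)\<bar>) powr 2 = 2 - 2 * cos t"
    using cos_double_sin[of "t/2"] by (simp add: power_mult_distrib)
  have "(2 * \<bar>sin (t / 2)\<bar>) powr (- 2 * d) = ((2 * \<bar>sin (t / 2)\<bar>) powr 2) powr (- d)"
    by (subst powr_powr) simp
  then show ?thesis unfolding fd_def 1 2 by simp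
qed

lemma fd_nonneg: "0 \<le> fd d t" by (simp add: fd_def)

lemma fd_measurable [measurable]: "fd d \<in> borel_measurable borel"
  unfolding fd_eq[abs_def] by measurable

lemma one_minus_cos_pos:
  fixes t :: real
  assumes "t \<in> {-pi..pi}" "t \<noteq> 0"
  shows "0 < 2 - 2 * cos t"
proof -
  have "cos \<bar>t\<bar> < cos 0" using assms by (intro cos_monotone_0_pi) auto
  then show ?thesis by simp
qed

definition fd_cov :: "real \<Rightarrow> int \<Rightarrow> real" where
  "fd_cov d n = (LINT t|lborel. circle t * fd d t * cos (of_int n * t))"

text \<open>The function is \<open>sgn s * \<bar>s\<bar> powr (1 - 2 * d)\<close>, with a positive
  exponent. Writing it with \<open>s\<^sup>2\<close> lets \<open>s = 2 * sin (t/2)\<close> turn the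
  base into \<open>2 - 2 * cos t\<close>, as in \<open>fd_eq\<close>.\<close>

lemma continuous_signed_powr:
  assumes "d < 1/2"
  shows "continuous_on UNIV (\<lambda>s::real. s * (s\<^sup>2) powr (- d))"
proof (clarsimp simp: continuous_on_eq_continuous_at)
  fix s :: real
  show "isCont (\<lambda>s. s * (s\<^sup>2) powr (- d)) s"
  proof (cases "s = 0")
    case False
    then show ?thesis by (intro continuous_intros) auto
  next
    case True
    have eq: "\<bar>s * (s\<^sup>2) powr (- d)\<bar> = \<bar>s\<bar> powr (1 - 2 * d)" for s :: real
    proof (cases "s = 0")
      case False
      have "\<bar>s\<bar> * (\<bar>s\<bar> powr 2) powr (- d) = \<bar>s\<bar> powr 1 * \<bar>s\<bar> powr (2 * - d)"
        unfolding powr_powr by simp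
      also have "\<dots> = \<bar>s\<bar> powr (1 - 2 * d)" by (subst powr_add[symmetric]) simp
      finally show ?thesis by (simp add: abs_mult False)
    qed (use assms in simp)
    have "continuous_on UNIV (\<lambda>s::real. \<bar>s\<bar> powr (1 - 2 * d))"
      using assms by (intro continuous_on_powr' continuous_intros) auto
    then have "isCont (\<lambda>s::real. \<bar>s\<bar> powr (1 - 2 * d)) 0"
      by (simp add: continuous_on_eq_continuous_at)
    from isContD[OF this] have "((\<lambda>s::real. \<bar>s\<bar> powr (1 - 2 * d)) \<longlongrightarrow> 0) (at 0)"
      using assms by simp
    then have "((\<lambda>s::real. s * (s\<^sup>2) powr (- d)) \<longlongrightarrow> 0) (at 0)"
      by (rule Lim_null_comparison[rotated]) (simp only: real_norm_def eq, simp)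
    then show ?thesis using True by (simp add: isCont_def)
  qed
qed

text \<open>By the addition formulas, \<open>H\<close> has as its derivative exactly the combination
  of \<open>fd d t * cos (n * t)\<close> and \<open>fd d t * cos ((n + 1) * t)\<close> in the claim,
  up to \<open>2 * pi\<close>. The factor \<open>cos ((n + 1/2) * t)\<close> vanishes at both ends
  of the period, so the derivative integrates to 0. The integrability of \<open>fd d\<close> is a
  hypothesis here; \<open>correlation_far\<close> derives it from that of
  \<open>fd d t * f0 t\<close>.\<close>

lemma fd_cov_rec:
  assumes d: "0 < d" "d < 1/2" and i: "integrable lborel (\<lambda>t. circle t * fd d t)"
  shows "(real n + 1 - d) * fd_cov d (int n + 1) = (real n + d) * fd_cov d (int n)"
proof -
  define \<nu> where "\<nu> = real n + 1/2"
  define H where "H t = 2 * sin (t/2) * ((2 * sin (t/2))\<^sup>2) powr (- d) * cos (\<nu> * t)" for t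
  define H' where "H' t = 2 * pi * ((real n + 1 - d) * (fd d t * cos (of_int (int n + 1) * t)) - (real n + d) * (fd d t * cos (of_int (int n) * t)))" for t
  have sq: "(2 * sin (t/2))\<^sup>2 = 2 - 2 * cos t" for t :: real
    using cos_double_sin[of "t/2"] by (simp add: power_mult_distrib)
  have deriv: "(H has_field_derivative H' t) (at t)" if t: "t \<in> {-pi..pi} - {0}" for t
  proof -
    have pos: "0 < 2 - 2 * cos t" using one_minus_cos_pos t by auto
    define P where "P = (2 - 2 * cos t) powr (- d)"
    have P1: "(2 - 2 * cos t) powr (- d - 1) * (2 - 2 * cos t) = P"
      using pos by (simp add: P_def powr_diff)
    have st: "sin t = 2 * sin (t/2) * cos (t/2)" using sin_double[of "t/2"] by simp
    have ct: "cos t = 1 - 2 * (sin (t/2))\<^sup>2" using cos_double_sin[of "t/2"] by simp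
    have c1: "cos (of_int (int n + 1) * t) = cos (\<nu> * t) * cos (t/2) - sin (\<nu> * t) * sin (t/2)"
      by (subst cos_add[symmetric]) (simp add: \<nu>_def algebra_simps)
    have c2: "cos (of_int (int n) * t) = cos (\<nu> * t) * cos (t/2) + sin (\<nu> * t) * sin (t/2)"
      by (subst cos_diff[symmetric]) (simp add: \<nu>_def algebra_simps)
    have "((\<lambda>t. 2 * sin (t/2) * (2 - 2 * cos t) powr (- d) * cos (\<nu> * t)) has_field_derivative
       (cos (t/2) * P + 2 * sin (t/2) * (- d * (2 - 2 * cos t) powr (- d - 1) * (2 * sin t))) * cos (\<nu> * t)
         + 2 * sin (t/2) * P * (- \<nu> * sin (\<nu> * t))) (at t)"
      using pos unfolding P_def by (auto intro!: derivative_eq_intros simp: algebra_simps)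
    also have "2 * sin (t/2) * (- d * (2 - 2 * cos t) powr (- d - 1) * (2 * sin t)) =
        - 2 * d * cos (t/2) * ((2 - 2 * cos t) powr (- d - 1) * (2 - 2 * cos t))"
      unfolding sq[symmetric] st by (simp add: power2_eq_square)
    also have "\<dots> = - 2 * d * cos (t/2) * P" by (simp only: P1)
    also have "(cos (t/2) * P + (- 2 * d * cos (t/2) * P)) * cos (\<nu> * t)
         + 2 * sin (t/2) * P * (- \<nu> * sin (\<nu> * t)) = H' t"
    proof -
      have fdP: "2 * pi * fd d t = P" by (simp add: fd_eq P_def)
      have n: "real n = \<nu> - 1/2" by (simp add: \<nu>_def)
      have "H' t = 2 * pi * fd d t * ((real n + 1 - d) * cos (of_int (int n + 1) * t) - (real n + d) * cos (of_int (int n) * t))"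
        unfolding H'_def by (simp only: right_diff_distrib mult_ac)
      then show ?thesis unfolding fdP c1 c2 n by (simp add: algebra_simps)
    qed
    finally show ?thesis unfolding H_def sq .
  qed
  \<comment> \<open>\<open>H\<close> is continuous at 0 but behaves there like a signed power with
    exponent \<open>1 - 2 * d\<close> below 1, so 0 is an exceptional point for the
    derivative.\<close>
  have "(H' has_integral (H pi - H (-pi))) {-pi..pi}"
  proof (rule fundamental_theorem_of_calculus_strong[of "{0}"])
    show "continuous_on {-pi..pi} H"
    proof -
      have "continuous_on {-pi..pi} (\<lambda>t. (\<lambda>s::real. s * (s\<^sup>2) powr (- d)) (2 * sin (t/2)))"
        by (rule continuous_on_compose2[OF continuous_signed_powr[OF d(2)]]) (auto intro!: continuous_intros)
      then show ?thesis unfolding H_def by (rule continuous_on_mult) (intro continuous_intros)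
    qed
  qed (use deriv in \<open>auto simp: has_real_derivative_iff_has_vector_derivative\<close>)
  also have "H pi - H (-pi) = 0"
  proof -
    have "cos (\<nu> * pi) = 0" unfolding \<nu>_def by (simp add: algebra_simps cos_add)
    then show ?thesis by (simp add: H_def)
  qed
  finally have I0: "(H' has_integral 0) {-pi..pi}" .
  have ic: "integrable lborel (\<lambda>t. circle t * fd d t * cos (of_int k * t))" for k
    by (intro integrable_mult_bounded[where B=1] i) auto
  have eq: "circle t * H' t = 2 * pi * ((real n + 1 - d) * (circle t * fd d t * cos (of_int (int n + 1) * t))
      - (real n + d) * (circle t * fd d t * cos (of_int (int n) * t)))" for t
    by (simp add: H'_def algebra_simps)
  have iH: "integrable lborel (\<lambda>t. circle t * H' t)"
    unfolding eq by (intro integrable_mult_right Bochner_Integration.integrable_diff ic)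
  have "(LINT t|lborel. circle t * H' t) = integral {-pi<..pi} H'"
    using set_borel_integral_eq_integral(2)[of "{-pi<..pi}" H'] iH
    by (simp add: set_integrable_def set_lebesgue_integral_def)
  also have "\<dots> = integral {-pi..pi} H'"
  proof (rule integral_spike_set)
    show "negligible {t \<in> {-pi<..pi} - {-pi..pi}. H' t \<noteq> 0}"
      by (rule negligible_subset[of "{}"]) auto
    show "negligible {t \<in> {-pi..pi} - {-pi<..pi}. H' t \<noteq> 0}"
      by (rule negligible_subset[of "{-pi}"]) auto
  qed
  also have "\<dots> = 0" using I0 by (rule integral_unique)
  finally have "(LINT t|lborel. circle t * H' t) = 0" .
  then have "2 * pi * ((real n + 1 - d) * fd_cov d (int n + 1) - (real n + d) * fd_cov d (int n)) = 0"
    unfolding eq fd_cov_def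
    by (simp only: integral_mult_right_zero Bochner_Integration.integral_diff
        integrable_mult_right[OF ic])
  then show ?thesis by simp
qed

lemma fd_cov_0_nonneg: "0 \<le> fd_cov d 0"
  unfolding fd_cov_def by (intro integral_nonneg_AE) (auto simp: fd_nonneg)

text \<open>Both sides satisfy the recursion of \<open>fd_cov_rec\<close>, whose factor
  \<open>real n + 1 - d\<close> never vanishes; the constant fits the value at 0.\<close>

lemma fd_cov_Beta:
  assumes d: "0 < d" "d < 1/2" and i: "integrable lborel (\<lambda>t. circle t * fd d t)"
  shows "fd_cov d (int n) = fd_cov d 0 / Beta d (1 - 2 * d) * Beta (real n + d) (1 - 2 * d)"
proof (induction n)
  case 0
  have "Beta d (1 - 2 * d) > 0" using d by (simp add: Beta_def Gamma_real_pos)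
  then show ?case by simp
next
  case (Suc n)
  have "(real n + d + (1 - 2 * d)) * Beta (real n + d + 1) (1 - 2 * d) = (real n + d) * Beta (real n + d) (1 - 2 * d)"
    using d by (intro Beta_plus1_left) (auto simp: nonpos_Ints_def)
  then have 1: "(real n + 1 - d) * Beta (real (Suc n) + d) (1 - 2 * d) = (real n + d) * Beta (real n + d) (1 - 2 * d)"
    by (simp add: algebra_simps)
  have 2: "(real n + 1 - d) * fd_cov d (int (Suc n)) = (real n + d) * fd_cov d (int n)"
    using fd_cov_rec[OF d i, of n] by (simp add: add.commute)
  have "(real n + 1 - d) * fd_cov d (int (Suc n)) = (real n + 1 - d) * (fd_cov d 0 / Beta d (1 - 2 * d) * Beta (real (Suc n) + d) (1 - 2 * d))"
    unfolding 2 Suc.IH using 1 by (simp add: mult.left_commute)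
  moreover have "real n + 1 - d \<noteq> 0" using d by simp
  ultimately show ?case using mult_left_cancel by blast
qed

text \<open>With \<open>p = 1 - 2 * d\<close> and \<open>a = n + 1 - d\<close>, one step of the
  recursion multiplies by \<open>1 - p / a\<close>. This is at most \<open>exp (- p / a)\<close>,
  hence at most \<open>((a + 1) / a) powr (- p)\<close>, and these factors telescope. The offset
  \<open>1 - d\<close> is there so that \<open>a\<close> is exactly the denominator of the
  recursion.\<close>

lemma fd_cov_decay:
  assumes d: "0 < d" "d < 1/2" and i: "integrable lborel (\<lambda>t. circle t * fd d t)"
  shows "fd_cov d (int n) \<le> fd_cov d 0 * (real n + 1 - d) powr (2 * d - 1)"
proof (induction n)
  case 0
  have "1 \<le> (1 - d) powr (2 * d - 1)" using d powr_mono'[of "2 * d - 1" 0 "1 - d"] by simp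
  then have "fd_cov d 0 * 1 \<le> fd_cov d 0 * (1 - d) powr (2 * d - 1)"
    by (intro mult_left_mono fd_cov_0_nonneg)
  then show ?case by simp
next
  case (Suc n)
  define p where "p = 1 - 2 * d"
  define a where "a = real n + 1 - d"
  have a: "a > 0" and p: "p > 0" using d by (auto simp: a_def p_def)
  have "fd_cov d (int (Suc n)) = (a - p) / a * fd_cov d (int n)"
    using fd_cov_rec[OF d i, of n] a by (simp add: a_def p_def field_simps)
  also have "\<dots> \<le> (a - p) / a * (fd_cov d 0 * a powr (2 * d - 1))"
    using Suc a by (intro mult_left_mono) (auto simp: a_def p_def d less_imp_le)
  also have "\<dots> \<le> exp (- (p / a)) * (fd_cov d 0 * a powr (2 * d - 1))"
  proof (intro mult_right_mono mult_nonneg_nonneg fd_cov_0_nonneg)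
    have "(a - p) / a = 1 + (- (p / a))" using a by (simp add: field_simps)
    then show "(a - p) / a \<le> exp (- (p / a))" using exp_ge_add_one_self[of "- (p / a)"] by simp
  qed simp
  also have "exp (- (p / a)) \<le> (1 + 1 / a) powr (- p)"
  proof -
    have "ln (1 + 1 / a) \<le> 1 / a" using a by (intro ln_add_one_self_le_self) auto
    then have "p * ln (1 + 1 / a) \<le> p * (1 / a)" using p by (intro mult_left_mono) auto
    moreover have "1 + 1 / a > 0" using a by (intro add_pos_pos) auto
    ultimately show ?thesis by (simp add: powr_def)
  qed
  also have "(1 + 1 / a) powr (- p) * (fd_cov d 0 * a powr (2 * d - 1)) = fd_cov d 0 * ((1 + 1 / a) * a) powr (2 * d - 1)"
    using a by (subst powr_mult) (auto simp: p_def)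
  also have "(1 + 1 / a) * a = real (Suc n) + 1 - d" using a by (simp add: field_simps a_def)
  finally show ?case by (simp add: mult_right_mono fd_cov_0_nonneg)
qed

section \<open>Point evaluation against the weight \<open>fd\<close>\<close>

text \<open>The real part of \<open>cnj U * V * cis (k * t)\<close>, which suffices because all
  covariances are real. Against a spectral density it integrates to the covariance of the blocks.
  The shift is an integer because \<open>cos_times_cross_form\<close> moves it in both
  directions.\<close>

definition cross_form :: "nat \<Rightarrow> int \<Rightarrow> (nat \<Rightarrow> real) \<Rightarrow> (nat \<Rightarrow> real) \<Rightarrow> real \<Rightarrow> real" where
  "cross_form b k u v t = (\<Sum>i=1..b. \<Sum>j=1..b. u i * v j * cos (of_int (k + int j - int i) * t))"

lemma cross_form_measurable [measurable]: "cross_form b k u v \<in> borel_measurable borel"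
  unfolding cross_form_def[abs_def] by measurable

lemma cross_form_bounded: "\<bar>cross_form b k u v t\<bar> \<le> (\<Sum>i=1..b. \<Sum>j=1..b. \<bar>u i * v j\<bar>)"
  unfolding cross_form_def
  by (intro order_trans[OF sum_abs] sum_mono) (simp add: abs_mult mult_left_le)

lemma cross_form_split:
  "cross_form b k u v t =
     (\<Sum>i=1..b. u i * cos (real i * t)) * (\<Sum>j=1..b. v j * cos (of_int (k + int j) * t)) +
     (\<Sum>i=1..b. u i * sin (real i * t)) * (\<Sum>j=1..b. v j * sin (of_int (k + int j) * t))"
proof -
  have "cos (of_int (k + int j - int i) * t) =
      cos (of_int (k + int j) * t) * cos (real i * t) + sin (of_int (k + int j) * t) * sin (real i * t)" for i j
    by (subst cos_diff[symmetric]) (simp add: algebra_simps)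
  then show ?thesis
    unfolding cross_form_def sum_product sum.distrib[symmetric]
    by (intro sum.cong refl) (simp add: algebra_simps)
qed

text \<open>The factor \<open>cis (k * t)\<close> does not change the modulus of \<open>V\<close>.
  The free \<open>k\<close> on the right is what makes \<open>cross_form_le\<close> uniform in the
  shift.\<close>

lemma cross_form_shift:
  "cross_form b 0 v v t =
     (\<Sum>j=1..b. v j * cos (of_int (k + int j) * t))\<^sup>2 + (\<Sum>j=1..b. v j * sin (of_int (k + int j) * t))\<^sup>2"
proof -
  have "cos (of_int (0 + int j - int i) * t) =
      cos (of_int (k + int j) * t) * cos (of_int (k + int i) * t) + sin (of_int (k + int j) * t) * sin (of_int (k + int i) * t)" for i j
    by (subst cos_diff[symmetric]) (simp add: algebra_simps)
  then show ?thesis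
    unfolding cross_form_def power2_eq_square sum_product sum.distrib[symmetric]
    by (intro sum.cong refl) (simp add: algebra_simps)
qed

lemma cross_form_diag:
  "cross_form b 0 v v t = (\<Sum>j=1..b. v j * cos (real j * t))\<^sup>2 + (\<Sum>j=1..b. v j * sin (real j * t))\<^sup>2"
  using cross_form_shift[of b v t 0] by simp

lemma cross_form_diag_nonneg: "0 \<le> cross_form b 0 v v t"
  by (simp add: cross_form_diag)

lemma weighted_am_gm:
  fixes x y s :: real
  assumes "s > 0"
  shows "2 * \<bar>x * y\<bar> \<le> s * x\<^sup>2 + y\<^sup>2 / s"
proof -
  have "0 \<le> (s * \<bar>x\<bar> - \<bar>y\<bar>)\<^sup>2 / s" using assms by simp
  also have "\<dots> = s * x\<^sup>2 + y\<^sup>2 / s - 2 * \<bar>x * y\<bar>"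
    using assms by (simp add: power2_diff abs_mult field_simps power2_eq_square[of s])
  finally show ?thesis by simp
qed

lemma cross_form_le:
  assumes "s > 0"
  shows "2 * \<bar>cross_form b k u v t\<bar> \<le> s * cross_form b 0 u u t + cross_form b 0 v v t / s"
proof -
  define A B C D where "A = (\<Sum>i=1..b. u i * cos (real i * t))" "B = (\<Sum>i=1..b. u i * sin (real i * t))"
    "C = (\<Sum>j=1..b. v j * cos (of_int (k + int j) * t))" "D = (\<Sum>j=1..b. v j * sin (of_int (k + int j) * t))"
  have "2 * \<bar>A * C + B * D\<bar> \<le> 2 * \<bar>A * C\<bar> + 2 * \<bar>B * D\<bar>"
    using abs_triangle_ineq[of "A * C" "B * D"] by simp
  also have "\<dots> \<le> (s * A\<^sup>2 + C\<^sup>2 / s) + (s * B\<^sup>2 + D\<^sup>2 / s)"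
    by (intro add_mono weighted_am_gm assms)
  also have "\<dots> = s * (A\<^sup>2 + B\<^sup>2) + (C\<^sup>2 + D\<^sup>2) / s" by (simp add: algebra_simps add_divide_distrib)
  finally show ?thesis
    unfolding cross_form_split[of b k u v] cross_form_diag[of b u] cross_form_shift[of b v t k] A_B_C_D_def .
qed

text \<open>Optimising over \<open>s\<close> turns an integrated arithmetic-geometric inequality
  into Cauchy--Schwarz. The best \<open>s\<close> is \<open>sqrt (D / A)\<close>; adding
  \<open>e\<close> to both keeps it defined when one of them is 0.\<close>

lemma le_geometric_mean:
  fixes X A D :: real
  assumes "A \<ge> 0" "D \<ge> 0" and le: "\<And>s. s > 0 \<Longrightarrow> X \<le> s * A + D / s"
  shows "X \<le> 2 * sqrt A * sqrt D"
proof -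
  have *: "X \<le> 2 * sqrt (A + e) * sqrt (D + e)" if e: "e > 0" for e
  proof -
    define a c where "a = sqrt (A + e)" "c = sqrt (D + e)"
    have pos: "a > 0" "c > 0" using assms e by (auto simp: a_c_def)
    have "X \<le> c / a * A + D / (c / a)" using pos by (intro le) auto
    also have "\<dots> \<le> c / a * a\<^sup>2 + c\<^sup>2 / (c / a)"
      using pos assms e by (intro add_mono mult_left_mono divide_right_mono) (auto simp: a_c_def)
    also have "\<dots> = 2 * a * c" using pos by (simp add: power2_eq_square)
    finally show ?thesis by (simp add: a_c_def)
  qed
  show ?thesis
  proof (rule tendsto_lowerbound)
    show "((\<lambda>e. 2 * sqrt (A + e) * sqrt (D + e)) \<longlongrightarrow> 2 * sqrt A * sqrt D) (at_right 0)"
      by (auto intro!: tendsto_eq_intros)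
    show "\<forall>\<^sub>F e in at_right 0. X \<le> 2 * sqrt (A + e) * sqrt (D + e)"
      using eventually_at_right_less[of "0::real"] by (rule eventually_mono) (rule *)
  qed simp
qed

section \<open>Parseval identities and the reproducing kernel\<close>

lemma integral_orthogonal_square:
  fixes \<phi> :: "nat \<Rightarrow> real \<Rightarrow> real"
  assumes [measurable]: "\<And>m. \<phi> m \<in> borel_measurable borel" and bd: "\<And>m t. \<bar>\<phi> m t\<bar> \<le> 1"
    and orth: "\<And>m l. (LINT t|lborel. circle t * (\<phi> m t * \<phi> l t)) = (if m = l then \<kappa> m else 0)"
  shows "(LINT t|lborel. circle t * (\<Sum>m<L. c m * \<phi> m t)\<^sup>2) = (\<Sum>m<L. (c m)\<^sup>2 * \<kappa> m)"
    and "integrable lborel (\<lambda>t. circle t * (\<Sum>m<L. c m * \<phi> m t)\<^sup>2)"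
proof -
  have i: "integrable lborel (\<lambda>t. circle t * (\<phi> m t * \<phi> l t))" for m l
  proof (rule integrable_mult_bounded[OF integrable_circle, where B=1])
    show "\<bar>\<phi> m t * \<phi> l t\<bar> \<le> 1" for t using mult_mono[OF bd[of m t] bd[of l t]] by (simp add: abs_mult)
  qed simp
  have eq: "circle t * (\<Sum>m<L. c m * \<phi> m t)\<^sup>2 = (\<Sum>m<L. \<Sum>l<L. c m * c l * (circle t * (\<phi> m t * \<phi> l t)))" for t
    unfolding power2_eq_square sum_product by (simp add: sum_distrib_left mult_ac)
  show "integrable lborel (\<lambda>t. circle t * (\<Sum>m<L. c m * \<phi> m t)\<^sup>2)"
    unfolding eq by (intro Bochner_Integration.integrable_sum integrable_mult_right i)
  have "(LINT t|lborel. circle t * (\<Sum>m<L. c m * \<phi> m t)\<^sup>2) =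
      (\<Sum>m<L. \<Sum>l<L. c m * c l * (LINT t|lborel. circle t * (\<phi> m t * \<phi> l t)))"
    unfolding eq by (simp add: Bochner_Integration.integral_sum Bochner_Integration.integrable_sum i)
  also have "\<dots> = (\<Sum>m<L. (c m)\<^sup>2 * \<kappa> m)"
    by (simp add: orth if_distrib[of "(*) _"] sum.delta power2_eq_square cong: if_cong)
  finally show "(LINT t|lborel. circle t * (\<Sum>m<L. c m * \<phi> m t)\<^sup>2) = (\<Sum>m<L. (c m)\<^sup>2 * \<kappa> m)" .
qed

lemma integral_circle_cos_cos:
  "(LINT t|lborel. circle t * (cos (real m * t) * cos (real l * t))) =
     (if m = l then (if m = 0 then 2 * pi else pi) else 0)"
proof -
  have "(LINT t|lborel. circle t * (cos (real m * t) * cos (real l * t))) =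
    (LINT t|lborel. 1/2 * (circle t * cos (of_int (int m + int l) * t) + circle t * cos (of_int (int m - int l) * t)))"
    by (intro Bochner_Integration.integral_cong refl) (simp add: algebra_simps cos_add cos_diff)
  also have "\<dots> = 1/2 * ((LINT t|lborel. circle t * cos (of_int (int m + int l) * t)) +
       (LINT t|lborel. circle t * cos (of_int (int m - int l) * t)))"
    by (subst integral_mult_right_zero, subst Bochner_Integration.integral_add)
       (auto intro!: integrable_mult_bounded[where B=1] integrable_circle)
  finally show ?thesis unfolding integral_circle_cos by auto
qed

lemma integral_circle_half_sin_sin:
  "(LINT t|lborel. circle t * (sin ((real m + 1/2) * t) * sin ((real l + 1/2) * t))) =
     (if m = l then pi else 0)"
proof -
  have 1: "cos (of_int (int m - int l) * t) = cos ((real m + 1/2) * t) * cos ((real l + 1/2) * t) + sin ((real m + 1/2) * t) * sin ((real l + 1/2) * t)" for t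
    by (subst cos_diff[symmetric]) (simp add: algebra_simps)
  have 2: "cos (of_int (int m + int l + 1) * t) = cos ((real m + 1/2) * t) * cos ((real l + 1/2) * t) - sin ((real m + 1/2) * t) * sin ((real l + 1/2) * t)" for t
    by (subst cos_add[symmetric]) (simp add: algebra_simps)
  have "(LINT t|lborel. circle t * (sin ((real m + 1/2) * t) * sin ((real l + 1/2) * t))) =
    (LINT t|lborel. 1/2 * (circle t * cos (of_int (int m - int l) * t) - circle t * cos (of_int (int m + int l + 1) * t)))"
    unfolding 1 2 by (intro Bochner_Integration.integral_cong refl) (simp add: algebra_simps)
  also have "\<dots> = 1/2 * ((LINT t|lborel. circle t * cos (of_int (int m - int l) * t)) -
       (LINT t|lborel. circle t * cos (of_int (int m + int l + 1) * t)))"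
    by (subst integral_mult_right_zero, subst Bochner_Integration.integral_diff)
       (auto intro!: integrable_mult_bounded[where B=1] integrable_circle)
  finally show ?thesis unfolding integral_circle_cos by auto
qed

text \<open>Abel summation based on \<open>2 * sin (t/2) * cos (m * t) = sin ((m + 1/2) * t) - sin
  ((m - 1/2) * t)\<close>. Since \<open>2 * \<bar>sin (t/2)\<bar>\<close> is the modulus of
  \<open>1 - cis t\<close>, it converts the weight with power 2 into differences of the
  coefficients.\<close>

lemma summation_by_parts_cos:
  fixes a :: "nat \<Rightarrow> real"
  shows "2 * sin (t/2) * (\<Sum>m<Suc L. (if m = 0 then 1 else 2) * a m * cos (real m * t)) =
     2 * (\<Sum>m<Suc L. (a m - a (Suc m)) * sin ((real m + 1/2) * t)) + 2 * a (Suc L) * sin ((real L + 1/2) * t)"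
proof (induction L)
  case 0
  then show ?case by (simp add: algebra_simps)
next
  case (Suc L)
  have 1: "sin ((real (Suc L) + 1/2) * t) = sin (real (Suc L) * t) * cos (t/2) + cos (real (Suc L) * t) * sin (t/2)"
    by (subst sin_add[symmetric]) (simp add: algebra_simps)
  have 2: "sin ((real L + 1/2) * t) = sin (real (Suc L) * t) * cos (t/2) - cos (real (Suc L) * t) * sin (t/2)"
    by (subst sin_diff[symmetric]) (simp add: algebra_simps)
  define X where "X = (\<Sum>m<Suc L. (if m = 0 then 1 else 2) * a m * cos (real m * t))"
  define Y where "Y = (\<Sum>m<Suc L. (a m - a (Suc m)) * sin ((real m + 1/2) * t))"
  have IH: "2 * sin (t/2) * X = 2 * Y + 2 * a (Suc L) * sin ((real L + 1/2) * t)"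
    unfolding X_def Y_def by (rule Suc)
  have "2 * sin (t/2) * (\<Sum>m<Suc (Suc L). (if m = 0 then 1 else 2) * a m * cos (real m * t)) =
      2 * sin (t/2) * X + 4 * a (Suc L) * (cos (real (Suc L) * t) * sin (t/2))"
    by (subst sum.lessThan_Suc, fold X_def) (simp add: algebra_simps)
  also have "\<dots> = 2 * Y + 2 * a (Suc L) * sin ((real (Suc L) + 1/2) * t)"
    unfolding IH 1 2 by (simp add: algebra_simps)
  also have "\<dots> = 2 * (\<Sum>m<Suc (Suc L). (a m - a (Suc m)) * sin ((real m + 1/2) * t))
      + 2 * a (Suc (Suc L)) * sin ((real (Suc L) + 1/2) * t)"
    by (subst sum.lessThan_Suc, fold Y_def) (simp add: algebra_simps)
  finally show ?case .
qed

text \<open>Duality: the tapered kernel \<open>q\<close> with Fourier coefficients \<open>x ^ \<bar>m\<bar>\<close> for \<open>\<bar>m\<bar> \<le> b\<close>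
  reproduces the value at \<open>x\<close>, and its norm in the space with weight \<open>1 / fd\<close> is controlled by
  interpolating \<open>\<bar>1 - cis t\<bar> powr (2 * d)\<close> between the powers \<open>0\<close> and \<open>2\<close> at scale \<open>1 / b\<close>.\<close>

lemma fd_point_evaluation:
  assumes d: "0 < d" "d < 1/2" and i: "integrable lborel (\<lambda>t. circle t * fd d t)"
    and b: "b \<ge> 1" and x: "0 < x" "x < 1"
  shows "\<bar>\<Sum>j=1..b. v j * x ^ j\<bar> \<le>
    4 * sqrt (real b powr (1 - 2 * d)) / x ^ b * sqrt (LINT t|lborel. circle t * fd d t * cross_form b 0 v v t)"
proof -
  \<comment> \<open>The taper is 1 up to \<open>b\<close>, so the coefficients that are evaluated
    stay exact, and falls linearly to 0 at \<open>2 * b\<close>, so its steps are at most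
    \<open>1 / b\<close> and summation by parts leaves no boundary term.\<close>
  define a where "a m = x ^ m * (if m \<le> 2 * b then min 1 (2 - real m / real b) else 0)" for m :: nat
  \<comment> \<open>By Bernoulli's inequality \<open>y\<close> dominates
    \<open>1 + b * (1 - x)\<close>, which is \<open>b\<close> times the bound for a difference of
    \<open>a\<close>: \<open>1 / b\<close> from the taper and \<open>1 - x\<close> from the
    power.\<close>
  define y where "y = 1 / x ^ b"
  have b0: "real b > 0" using b by simp
  have y: "1 + real b * (1 - x) \<le> y" "1 \<le> y"
  proof -
    have "1 + real b * (1 - x) \<le> 1 + real b * (1 / x - 1)"
    proof (intro add_left_mono mult_left_mono)
      have "0 \<le> (1 - x)\<^sup>2" by simp
      then show "1 - x \<le> 1 / x - 1" using x by (simp add: field_simps power2_eq_square)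
    qed simp
    also have "\<dots> \<le> (1 + (1 / x - 1)) ^ b"
      using x by (intro Bernoulli_inequality) auto
    finally show 1: "1 + real b * (1 - x) \<le> y" by (simp add: y_def power_divide)
    have "0 \<le> real b * (1 - x)" using x by simp
    with 1 show "1 \<le> y" by linarith
  qed
  have taper: "0 \<le> (if m \<le> 2 * b then min 1 (2 - real m / real b) else 0)"
      "(if m \<le> 2 * b then min 1 (2 - real m / real b) else 0) \<le> 1" for m
  proof -
    have "real m / real b \<le> 2" if "m \<le> 2 * b"
      using that b0 by (simp add: divide_le_eq)
    then show "0 \<le> (if m \<le> 2 * b then min 1 (2 - real m / real b) else 0)"
      "(if m \<le> 2 * b then min 1 (2 - real m / real b) else 0) \<le> 1" by auto
  qed
  have a1: "\<bar>a m\<bar> \<le> 1" for m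
    unfolding a_def abs_mult using taper[of m] x by (intro mult_le_one) (auto simp: power_le_one)
  have aL: "a (2 * b) = 0" using b0 by (simp add: a_def)
  have aj: "a j = x ^ j" if "j \<le> b" for j
    using that b0 by (auto simp: a_def min_def field_simps)
  have da: "\<bar>a m - a (Suc m)\<bar> \<le> y / real b" for m
  proof -
    define \<tau> where "\<tau> m = (if m \<le> 2 * b then min 1 (2 - real m / real b) else 0)" for m :: nat
    have t1: "\<bar>\<tau> m - \<tau> (Suc m)\<bar> \<le> 1 / real b"
    proof -
      have s: "real (Suc m) / real b = real m / real b + 1 / real b" by (simp add: add_divide_distrib)
      have p: "0 < 1 / real b" using b0 by simp
      consider "Suc m \<le> 2 * b" | "m = 2 * b" | "m > 2 * b" by linarith
      then show ?thesis
      proof cases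
        case 1
        have "\<bar>min 1 (2 - r) - min 1 (2 - (r + e))\<bar> \<le> e" if "0 < e" for r e :: real
          using that by (auto simp: min_def)
        from this[OF p, of "real m / real b"] 1 show ?thesis by (simp only: \<tau>_def s) simp
      qed (use p b0 in \<open>auto simp: \<tau>_def\<close>)
    qed
    have "a m - a (Suc m) = x ^ m * (\<tau> m - \<tau> (Suc m)) + x ^ m * (1 - x) * \<tau> (Suc m)"
      by (simp add: a_def \<tau>_def algebra_simps)
    also have "\<bar>\<dots>\<bar> \<le> \<bar>x ^ m * (\<tau> m - \<tau> (Suc m))\<bar> + \<bar>x ^ m * (1 - x) * \<tau> (Suc m)\<bar>" by simp
    also have "\<dots> \<le> 1 * (1 / real b) + 1 * (1 - x) * 1"
      unfolding abs_mult using t1 x taper[of "Suc m"]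
      by (intro add_mono mult_mono) (auto simp: \<tau>_def power_le_one)
    also have "\<dots> = (1 + real b * (1 - x)) / real b" using b0 by (simp add: field_simps)
    also have "\<dots> \<le> y / real b" using y b0 by (intro divide_right_mono) auto
    finally show ?thesis .
  qed
  define L where "L = 2 * b"
  define q where "q t = (\<Sum>m<L. (if m = 0 then 1 else 2) * a m * cos (real m * t))" for t
  define h where "h t = (\<Sum>m<L. (a m - a (Suc m)) * sin ((real m + 1/2) * t))" for t
  obtain L' where L': "L = Suc L'" using b by (cases L) (auto simp: L_def)
  have qh: "2 * sin (t/2) * q t = 2 * h t" for t
    using summation_by_parts_cos[of t a L'] aL unfolding q_def h_def L'[symmetric] by (simp add: L_def)
  have qint: "integrable lborel (\<lambda>t. circle t * (q t)\<^sup>2)" "(LINT t|lborel. circle t * (q t)\<^sup>2) \<le> 16 * pi * real b"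
  proof -
    show "integrable lborel (\<lambda>t. circle t * (q t)\<^sup>2)"
      unfolding q_def by (rule integral_orthogonal_square(2)[where \<kappa>="\<lambda>m. if m = 0 then 2 * pi else pi"])
         (use integral_circle_cos_cos in auto)
    have "(LINT t|lborel. circle t * (q t)\<^sup>2) = (\<Sum>m<L. ((if m = 0 then 1 else 2) * a m)\<^sup>2 * (if m = 0 then 2 * pi else pi))"
      unfolding q_def by (rule integral_orthogonal_square(1)) (use integral_circle_cos_cos in auto)
    also have "\<dots> \<le> (\<Sum>m<L. 8 * pi)"
    proof (rule sum_mono)
      fix m
      have "((if m = 0 then 1 else 2) * a m)\<^sup>2 \<le> 2\<^sup>2"
        using a1[of m] by (subst abs_le_square_iff[symmetric]) auto
      then show "((if m = 0 then 1 else 2) * a m)\<^sup>2 * (if m = 0 then 2 * pi else pi) \<le> 8 * pi"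
        using mult_mono[of "((if m = 0 then 1 else 2) * a m)\<^sup>2" "2\<^sup>2" "(if m = 0 then 2 * pi else pi)" "2 * pi"]
        by auto
    qed
    finally show "(LINT t|lborel. circle t * (q t)\<^sup>2) \<le> 16 * pi * real b" by (simp add: L_def mult_ac)
  qed
  have hint: "integrable lborel (\<lambda>t. circle t * (h t)\<^sup>2)" "(real b)\<^sup>2 * (LINT t|lborel. circle t * (h t)\<^sup>2) \<le> 2 * pi * real b * y\<^sup>2"
  proof -
    show "integrable lborel (\<lambda>t. circle t * (h t)\<^sup>2)"
      unfolding h_def by (rule integral_orthogonal_square(2)[where \<kappa>="\<lambda>m. pi"])
         (use integral_circle_half_sin_sin in auto)
    have "(LINT t|lborel. circle t * (h t)\<^sup>2) = (\<Sum>m<L. (a m - a (Suc m))\<^sup>2 * pi)"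
      unfolding h_def by (rule integral_orthogonal_square(1)) (use integral_circle_half_sin_sin in auto)
    also have "\<dots> \<le> (\<Sum>m<L. (y / real b)\<^sup>2 * pi)"
      using da y b0 by (intro sum_mono mult_right_mono) (auto simp flip: abs_le_square_iff)
    also have "\<dots> = 2 * real b * ((y / real b)\<^sup>2 * pi)" by (simp add: L_def)
    finally have "(real b)\<^sup>2 * (LINT t|lborel. circle t * (h t)\<^sup>2) \<le> (real b)\<^sup>2 * (2 * real b * ((y / real b)\<^sup>2 * pi))"
      by (rule mult_left_mono) simp
    also have "\<dots> = 2 * pi * real b * y\<^sup>2" using b0 by (simp add: power_divide)
    finally show "(real b)\<^sup>2 * (LINT t|lborel. circle t * (h t)\<^sup>2) \<le> 2 * pi * real b * y\<^sup>2" .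
  qed
  \<comment> \<open>The kernel \<open>q\<close> is even, so the real part of the polynomial of
    \<open>v\<close> is enough; its square is at most the diagonal form.\<close>
  define C where "C t = (\<Sum>j=1..b. v j * cos (real j * t))" for t
  have Cq: "(LINT t|lborel. circle t * (C t * q t)) = 2 * pi * (\<Sum>j=1..b. v j * x ^ j)"
    "integrable lborel (\<lambda>t. circle t * (C t * q t))"
  proof -
    have ic: "integrable lborel (\<lambda>t. circle t * (cos (real j * t) * cos (real m * t)))" for j m
    proof (rule integrable_mult_bounded[OF integrable_circle, where B=1])
      show "\<bar>cos (real j * t) * cos (real m * t)\<bar> \<le> 1" for t
        using mult_mono[OF abs_cos_le_one[of "real j * t"] abs_cos_le_one[of "real m * t"]] by (simp add: abs_mult)
    qed simp
    have eq: "circle t * (C t * q t) = (\<Sum>j=1..b. \<Sum>m<L. v j * ((if m = 0 then 1 else 2) * a m) * (circle t * (cos (real j * t) * cos (real m * t))))" for t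
      unfolding C_def q_def sum_product by (simp add: sum_distrib_left mult_ac)
    show "integrable lborel (\<lambda>t. circle t * (C t * q t))"
      unfolding eq by (intro Bochner_Integration.integrable_sum integrable_mult_right ic)
    have "(LINT t|lborel. circle t * (C t * q t)) = (\<Sum>j=1..b. \<Sum>m<L. v j * ((if m = 0 then 1 else 2) * a m) * (LINT t|lborel. circle t * (cos (real j * t) * cos (real m * t))))"
      unfolding eq by (simp only: Bochner_Integration.integral_sum Bochner_Integration.integrable_sum integrable_mult_right ic integral_mult_right_zero)
    also have "\<dots> = (\<Sum>j=1..b. 2 * pi * (v j * x ^ j))"
    proof (rule sum.cong)
      fix j assume j: "j \<in> {1..b}"
      have "(\<Sum>m<L. v j * ((if m = 0 then 1 else 2) * a m) * (LINT t|lborel. circle t * (cos (real j * t) * cos (real m * t))))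
        = (\<Sum>m<L. if m = j then v j * (2 * a j) * pi else 0)"
        unfolding integral_circle_cos_cos using j by (intro sum.cong) auto
      also have "\<dots> = v j * (2 * a j) * pi" using j by (simp add: L_def)
      also have "\<dots> = 2 * pi * (v j * x ^ j)" using aj[of j] j by simp
      finally show "(\<Sum>m<L. v j * ((if m = 0 then 1 else 2) * a m) * (LINT t|lborel. circle t * (cos (real j * t) * cos (real m * t))))
        = 2 * pi * (v j * x ^ j)" .
    qed simp
    finally show "(LINT t|lborel. circle t * (C t * q t)) = 2 * pi * (\<Sum>j=1..b. v j * x ^ j)"
      by (simp add: sum_distrib_left)
  qed
  define Q where "Q = (LINT t|lborel. circle t * fd d t * cross_form b 0 v v t)"
  have iQ: "integrable lborel (\<lambda>t. circle t * fd d t * cross_form b 0 v v t)"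
    by (rule integrable_mult_bounded[OF i _ cross_form_bounded]) simp
  have Q0: "Q \<ge> 0" unfolding Q_def
    by (intro integral_nonneg_AE AE_I2 mult_nonneg_nonneg cross_form_diag_nonneg fd_nonneg) auto
  \<comment> \<open>An upper bound for the integral of \<open>(q t)\<^sup>2 / fd d t\<close>, the
    squared dual norm of the kernel.\<close>
  define D where "D = 2 * pi * real b powr (- 2 * d) * (16 * pi * real b + 8 * pi * real b * y\<^sup>2)"
  have "4 * pi * \<bar>\<Sum>j=1..b. v j * x ^ j\<bar> \<le> s * Q + D / s" if s: "s > 0" for s
  proof -
    have pw: "2 * \<bar>circle t * (C t * q t)\<bar> \<le> s * (circle t * fd d t * cross_form b 0 v v t)
      + 2 * pi * real b powr (- 2 * d) / s * (circle t * (q t)\<^sup>2 + 4 * (real b)\<^sup>2 * (circle t * (h t)\<^sup>2))" (is "?l \<le> ?r")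
      if t: "t \<noteq> 0" for t
    proof (cases "t \<in> {-pi<..pi}")
      case True
      define c where "c = 2 - 2 * cos t"
      have c: "c > 0" using one_minus_cos_pos[of t] True t by (auto simp: c_def)
      define F where "F = fd d t"
      have F: "F = c powr (- d) / (2 * pi)" by (simp add: F_def fd_eq c_def)
      have Fpos: "F > 0" using c by (simp add: F)
      have Finv: "1 / F = 2 * pi * c powr d" using c by (simp add: F powr_minus divide_simps)
      \<comment> \<open>The interpolation at scale \<open>1 / b\<close>: the term 1 is paid for by
        the integral of \<open>q\<^sup>2\<close>, the term with \<open>c\<close> by that of
        \<open>h\<^sup>2\<close>, through
        \<open>c * (q t)\<^sup>2 = 4 * (h t)\<^sup>2\<close>.\<close>
      have "((real b)\<^sup>2 * c) powr d \<le> 1 + (real b)\<^sup>2 * c"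
      proof (cases "(real b)\<^sup>2 * c \<le> 1")
        case True
        then have "((real b)\<^sup>2 * c) powr d \<le> 1" using c d by (intro powr_le1) auto
        then show ?thesis using c by (simp add: add_increasing2)
      next
        case False
        then have "((real b)\<^sup>2 * c) powr d \<le> ((real b)\<^sup>2 * c) powr 1" using d by (intro powr_mono) auto
        then show ?thesis using c by simp
      qed
      moreover have "((real b)\<^sup>2 * c) powr d = real b powr (2 * d) * c powr d"
        using b0 c by (simp add: powr_mult powr_powr flip: powr_numeral)
      ultimately have "real b powr (- 2 * d) * (real b powr (2 * d) * c powr d) \<le> real b powr (- 2 * d) * (1 + (real b)\<^sup>2 * c)"
        by (intro mult_left_mono) auto
      moreover have "real b powr (- 2 * d) * real b powr (2 * d) = 1"
        using b0 by (subst powr_add[symmetric]) simp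
      ultimately have cd: "c powr d \<le> real b powr (- 2 * d) * (1 + (real b)\<^sup>2 * c)"
        by (simp only: mult.assoc[symmetric] mult_1_left)
      have cq: "c * (q t)\<^sup>2 = 4 * (h t)\<^sup>2"
      proof -
        have "c = (2 * sin (t/2))\<^sup>2" using cos_double_sin[of "t/2"] by (simp add: c_def power_mult_distrib)
        then have "c * (q t)\<^sup>2 = (2 * sin (t/2) * q t)\<^sup>2" by (simp add: power_mult_distrib)
        then show ?thesis unfolding qh by (simp add: power_mult_distrib)
      qed
      have "2 * \<bar>C t * q t\<bar> \<le> (s * F) * (C t)\<^sup>2 + (q t)\<^sup>2 / (s * F)"
        using s Fpos by (intro weighted_am_gm) auto
      also have "(q t)\<^sup>2 / (s * F) = (q t)\<^sup>2 / s * (1 / F)" by simp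
      also have "\<dots> = (2 * pi / s * (q t)\<^sup>2) * c powr d" unfolding Finv by simp
      also have "\<dots> \<le> (2 * pi / s * (q t)\<^sup>2) * (real b powr (- 2 * d) * (1 + (real b)\<^sup>2 * c))"
        using s by (intro mult_left_mono cd) auto
      also have "\<dots> = 2 * pi * real b powr (- 2 * d) / s * ((q t)\<^sup>2 + (real b)\<^sup>2 * (c * (q t)\<^sup>2))"
        by (simp add: algebra_simps)
      also have "(s * F) * (C t)\<^sup>2 \<le> (s * F) * cross_form b 0 v v t"
        using s Fpos by (intro mult_left_mono) (auto simp: C_def cross_form_diag)
      finally show ?thesis using True unfolding cq by (simp add: F_def mult_ac)
    qed auto
    have "2 * \<bar>LINT t|lborel. circle t * (C t * q t)\<bar> \<le> (LINT t|lborel. 2 * \<bar>circle t * (C t * q t)\<bar>)"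
      using integral_abs_bound[of lborel "\<lambda>t. circle t * (C t * q t)"] by simp
    also have "\<dots> \<le> (LINT t|lborel. s * (circle t * fd d t * cross_form b 0 v v t)
      + 2 * pi * real b powr (- 2 * d) / s * (circle t * (q t)\<^sup>2 + 4 * (real b)\<^sup>2 * (circle t * (h t)\<^sup>2)))"
    proof (rule integral_mono_AE)
      have "AE t in lborel. t \<noteq> (0::real)" by (rule AE_lborel_singleton)
      then show "AE t in lborel. 2 * \<bar>circle t * (C t * q t)\<bar> \<le> s * (circle t * fd d t * cross_form b 0 v v t)
        + 2 * pi * real b powr (- 2 * d) / s * (circle t * (q t)\<^sup>2 + 4 * (real b)\<^sup>2 * (circle t * (h t)\<^sup>2))"
        by eventually_elim (rule pw)
      show "integrable lborel (\<lambda>t. 2 * \<bar>circle t * (C t * q t)\<bar>)"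
        by (intro integrable_mult_right integrable_abs Cq)
      show "integrable lborel (\<lambda>t. s * (circle t * fd d t * cross_form b 0 v v t)
        + 2 * pi * real b powr (- 2 * d) / s * (circle t * (q t)\<^sup>2 + 4 * (real b)\<^sup>2 * (circle t * (h t)\<^sup>2)))"
        by (intro Bochner_Integration.integrable_add integrable_mult_right qint hint iQ)
    qed
    also have "\<dots> = s * Q + 2 * pi * real b powr (- 2 * d) / s *
       ((LINT t|lborel. circle t * (q t)\<^sup>2) + 4 * ((real b)\<^sup>2 * (LINT t|lborel. circle t * (h t)\<^sup>2)))"
      unfolding mult.assoc[of 4, symmetric]
      by (simp only: Bochner_Integration.integral_add Bochner_Integration.integrable_add integrable_mult_right
        integral_mult_right_zero qint hint iQ Q_def)
    also have "\<dots> \<le> s * Q + 2 * pi * real b powr (- 2 * d) / s * (16 * pi * real b + 4 * (2 * pi * real b * y\<^sup>2))"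
      using s by (intro add_left_mono mult_left_mono add_mono qint hint) auto
    also have "\<dots> = s * Q + D / s" by (simp add: D_def)
    finally show ?thesis unfolding Cq abs_mult by simp
  qed
  moreover have D0: "D \<ge> 0" by (simp add: D_def)
  ultimately have fin: "4 * pi * \<bar>\<Sum>j=1..b. v j * x ^ j\<bar> \<le> 2 * sqrt Q * sqrt D"
    by (intro le_geometric_mean Q0) auto
  have "D \<le> 2 * pi * real b powr (- 2 * d) * (16 * pi * real b * y\<^sup>2 + 8 * pi * real b * y\<^sup>2)"
    unfolding D_def using y b0 by (intro mult_left_mono add_mono) (auto simp: one_le_power)
  also have "\<dots> = 48 * pi\<^sup>2 * (real b powr (- 2 * d) * real b powr 1) * y\<^sup>2"
    by (simp add: power2_eq_square)
  also have "\<dots> = 48 * pi\<^sup>2 * real b powr (1 - 2 * d) * y\<^sup>2"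
    by (subst powr_add[symmetric]) simp
  \<comment> \<open>Rounding 48 up to 64 gives an exact root; the constant 4 of the statement is
    \<open>2 * (8 * pi) / (4 * pi)\<close>.\<close>
  also have "\<dots> \<le> (8 * pi)\<^sup>2 * real b powr (1 - 2 * d) * y\<^sup>2"
    by (intro mult_right_mono) (auto simp: power_mult_distrib)
  finally have "sqrt D \<le> sqrt ((8 * pi)\<^sup>2 * real b powr (1 - 2 * d) * y\<^sup>2)" by simp
  also have "\<dots> = 8 * pi * sqrt (real b powr (1 - 2 * d)) * y" using y by (simp add: real_sqrt_mult)
  finally have "2 * sqrt Q * sqrt D \<le> 2 * sqrt Q * (8 * pi * sqrt (real b powr (1 - 2 * d)) * y)"
    using Q0 by (intro mult_left_mono) auto
  also have "2 * sqrt Q * (8 * pi * sqrt (real b powr (1 - 2 * d)) * y) =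
      4 * pi * (4 * sqrt (real b powr (1 - 2 * d)) * y * sqrt Q)"
    by (simp only: mult_ac)
  finally have "4 * pi * \<bar>\<Sum>j=1..b. v j * x ^ j\<bar> \<le> 4 * pi * (4 * sqrt (real b powr (1 - 2 * d)) * y * sqrt Q)"
    using fin by (rule order_trans[rotated])
  then have "\<bar>\<Sum>j=1..b. v j * x ^ j\<bar> \<le> 4 * sqrt (real b powr (1 - 2 * d)) * y * sqrt Q"
    by (rule mult_left_le_imp_le) simp
  then show ?thesis unfolding Q_def[symmetric] by (simp add: y_def)
qed

text \<open>Reversing the coefficients conjugates the polynomial on the circle, up to a unimodular
  factor. It is needed because \<open>i\<close> enters the lag with a minus sign, so
  \<open>u\<close> has to be read backwards to give a polynomial in \<open>x\<close>.\<close>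

lemma cross_form_reverse: "cross_form b 0 (\<lambda>i. v (b + 1 - i)) (\<lambda>i. v (b + 1 - i)) t = cross_form b 0 v v t"
proof -
  have "cross_form b 0 (\<lambda>i. v (b + 1 - i)) (\<lambda>i. v (b + 1 - i)) t =
    (\<Sum>i=1..b. \<Sum>j=1..b. v (b + 1 - i) * v (b + 1 - j) * cos (of_int (int (b + 1 - i) - int (b + 1 - j)) * t))"
    unfolding cross_form_def by (intro sum.cong refl) (auto simp: of_nat_diff algebra_simps)
  also have "\<dots> = (\<Sum>i=1..b. \<Sum>j=1..b. v i * v j * cos (of_int (int i - int j) * t))"
  proof -
    have rev: "(\<Sum>i=1..b. f (b + 1 - i)) = (\<Sum>i=1..b. f i)" for f :: "nat \<Rightarrow> real"
      using sum.atLeastAtMost_rev[of f 1 b] by (simp add: add.commute)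
    define g where "g i j = v i * v j * cos (of_int (int i - int j) * t)" for i j
    have "(\<Sum>i=1..b. \<Sum>j=1..b. g (b + 1 - i) (b + 1 - j)) = (\<Sum>i=1..b. \<Sum>j=1..b. g i j)"
      by (simp only: rev rev[of "\<lambda>i. \<Sum>j=1..b. g i j"])
    then show ?thesis by (simp only: g_def)
  qed
  also have "\<dots> = cross_form b 0 v v t"
    unfolding cross_form_def by (subst sum.swap) (simp add: mult.commute mult.left_commute)
  finally show ?thesis .
qed

section \<open>Distant blocks for the pure weight \<open>fd\<close>\<close>

lemma integral_cross_form:
  assumes w: "integrable lborel w"
  shows "(LINT t|lborel. w t * cross_form b k u v t) =
    (\<Sum>i=1..b. \<Sum>j=1..b. u i * v j * (LINT t|lborel. w t * cos (of_int (k + int j - int i) * t)))"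
    and "integrable lborel (\<lambda>t. w t * cross_form b k u v t)"
proof -
  have ic: "integrable lborel (\<lambda>t. w t * cos (of_int k * t))" for k :: int
    by (intro integrable_mult_bounded[where B=1] w) auto
  have eq: "w t * cross_form b k u v t = (\<Sum>i=1..b. \<Sum>j=1..b. u i * v j * (w t * cos (of_int (k + int j - int i) * t)))" for t
    by (simp add: cross_form_def sum_distrib_left mult_ac)
  show "integrable lborel (\<lambda>t. w t * cross_form b k u v t)"
    by (rule integrable_mult_bounded[OF w _ cross_form_bounded]) simp
  show "(LINT t|lborel. w t * cross_form b k u v t) =
    (\<Sum>i=1..b. \<Sum>j=1..b. u i * v j * (LINT t|lborel. w t * cos (of_int (k + int j - int i) * t)))"
    unfolding eq by (simp only: Bochner_Integration.integral_sum Bochner_Integration.integrable_sum integrable_mult_right ic integral_mult_right_zero)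
qed

text \<open>The lag splits as \<open>k + j - i = n + 2 * b + (b + 1 - i) + j\<close>. The last two
  terms give the reversed polynomial of \<open>u\<close> and the polynomial of \<open>v\<close>; the
  reserve \<open>2 * b\<close> absorbs the factor \<open>1 / x ^ b\<close> from each point
  evaluation. What remains is the Beta weight of index \<open>n\<close>, which integrates back to
  \<open>fd_cov d (int n)\<close>. The constant 16 is \<open>4 * 4\<close>.\<close>

lemma fd_cross_form_bound:
  assumes d: "0 < d" "d < 1/2" and i: "integrable lborel (\<lambda>t. circle t * fd d t)"
    and b: "b \<ge> 1" and k: "k = int n + 3 * int b + 1"
  defines "Q \<equiv> \<lambda>w. LINT t|lborel. circle t * fd d t * cross_form b 0 w w t"
  shows "\<bar>LINT t|lborel. circle t * fd d t * cross_form b k u v t\<bar> \<le>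
    16 * real b powr (1 - 2 * d) * fd_cov d (int n) * (sqrt (Q u) * sqrt (Q v))"
proof -
  define \<kappa> where "\<kappa> = fd_cov d 0 / Beta d (1 - 2 * d)"
  have "Beta d (1 - 2 * d) > 0" using d by (simp add: Beta_def Gamma_real_pos)
  then have \<kappa>: "\<kappa> \<ge> 0" by (simp add: \<kappa>_def fd_cov_0_nonneg)
  define B where "B = 16 * real b powr (1 - 2 * d) * (sqrt (Q u) * sqrt (Q v))"
  have Q0: "Q w \<ge> 0" for w unfolding Q_def
    by (intro integral_nonneg_AE AE_I2 mult_nonneg_nonneg cross_form_diag_nonneg fd_nonneg) auto
  \<comment> \<open>The subtraction on naturals is exact because \<open>i \<le> b\<close>.\<close>
  define N where "N i j = n + 3 * b + 1 + j - i" for i j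
  define G where "G x = (\<Sum>i=1..b. \<Sum>j=1..b. u i * v j * (x powr (real (N i j) + d - 1) * (1 - x) powr (1 - 2 * d - 1)))" for x
  define R where "R x = B * (x powr (real n + d - 1) * (1 - x) powr (1 - 2 * d - 1))" for x
  have Beta: "((\<lambda>x. x powr (real m + d - 1) * (1 - x) powr (1 - 2 * d - 1)) has_integral Beta (real m + d) (1 - 2 * d)) {0..1}" for m
    using has_integral_Beta_real[of "real m + d" "1 - 2 * d"] d by simp
  have Gint: "(G has_integral (\<Sum>i=1..b. \<Sum>j=1..b. u i * v j * Beta (real (N i j) + d) (1 - 2 * d))) {0..1}"
    unfolding G_def by (intro has_integral_sum has_integral_mult_right Beta) auto
  have Rint: "(R has_integral (B * Beta (real n + d) (1 - 2 * d))) {0..1}"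
    unfolding R_def by (intro has_integral_mult_right Beta)
  \<comment> \<open>At both end points \<open>0 powr a = 0\<close> makes the two sides 0, so only
    interior points need the evaluation bound.\<close>
  have GR: "\<bar>G x\<bar> \<le> R x" if x: "x \<in> {0..1}" for x
  proof (cases "x = 0 \<or> x = 1")
    case True
    then show ?thesis by (auto simp: G_def R_def)
  next
    case False
    with x have x: "0 < x" "x < 1" by auto
    define U V where "U = (\<Sum>i=1..b. u (b + 1 - i) * x ^ i)" "V = (\<Sum>j=1..b. v j * x ^ j)"
    define z where "z = x powr (real n + 2 * real b + d - 1) * (1 - x) powr (1 - 2 * d - 1)"
    have U': "U = (\<Sum>i=1..b. u i * x ^ (b + 1 - i))"
      unfolding U_V_def using sum.atLeastAtMost_rev[of "\<lambda>i. u (b + 1 - i) * x ^ i" 1 b] by (simp add: add.commute)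
    have "G x = z * (U * V)"
      unfolding U' U_V_def(2) sum_product unfolding sum_distrib_left G_def
    proof (intro sum.cong refl)
      fix i j assume ij: "i \<in> {1..b}" "j \<in> {1..b}"
      have "x powr (real (N i j) + d - 1) = x powr (real n + 2 * real b + d - 1) * x powr (real (b + 1 - i)) * x powr (real j)"
        using ij by (simp add: powr_add[symmetric] N_def of_nat_diff algebra_simps)
      also have "\<dots> = x powr (real n + 2 * real b + d - 1) * x ^ (b + 1 - i) * x ^ j"
        using x by (simp only: powr_realpow)
      finally show "u i * v j * (x powr (real (N i j) + d - 1) * (1 - x) powr (1 - 2 * d - 1)) =
          z * (u i * x ^ (b + 1 - i) * (v j * x ^ j))"
        by (simp add: z_def)
    qed
    also have "\<bar>\<dots>\<bar> = z * (\<bar>U\<bar> * \<bar>V\<bar>)" by (simp add: abs_mult z_def)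
    also have "\<dots> \<le> z * ((4 * sqrt (real b powr (1 - 2 * d)) / x ^ b * sqrt (Q u)) * (4 * sqrt (real b powr (1 - 2 * d)) / x ^ b * sqrt (Q v)))"
    proof (intro mult_left_mono mult_mono)
      show "\<bar>U\<bar> \<le> 4 * sqrt (real b powr (1 - 2 * d)) / x ^ b * sqrt (Q u)"
        using fd_point_evaluation[OF d i b x, of "\<lambda>i. u (b + 1 - i)"]
        unfolding cross_form_reverse U_V_def Q_def .
      show "\<bar>V\<bar> \<le> 4 * sqrt (real b powr (1 - 2 * d)) / x ^ b * sqrt (Q v)"
        using fd_point_evaluation[OF d i b x, of v] unfolding U_V_def Q_def .
    qed (use x Q0 in \<open>auto simp: z_def\<close>)
    also have "\<dots> = B * (z / (x ^ b * x ^ b))" by (simp add: B_def mult_ac)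
    also have "z / (x ^ b * x ^ b) = x powr (real n + d - 1) * (1 - x) powr (1 - 2 * d - 1)"
    proof -
      have "x powr (real n + 2 * real b + d - 1) = x powr (real n + d - 1) * (x powr real b * x powr real b)"
        by (simp add: powr_add[symmetric] algebra_simps)
      also have "\<dots> = x powr (real n + d - 1) * (x ^ b * x ^ b)" using x by (simp only: powr_realpow)
      finally show ?thesis using x by (simp add: z_def)
    qed
    finally show ?thesis unfolding R_def .
  qed
  have "(LINT t|lborel. circle t * fd d t * cross_form b k u v t) =
      (\<Sum>i=1..b. \<Sum>j=1..b. u i * v j * fd_cov d (k + int j - int i))"
    unfolding fd_cov_def by (rule integral_cross_form[OF i])
  also have "\<dots> = (\<Sum>i=1..b. \<Sum>j=1..b. u i * v j * (\<kappa> * Beta (real (N i j) + d) (1 - 2 * d)))"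
  proof (intro sum.cong refl)
    fix i' j assume ij: "i' \<in> {1..b}" "j \<in> {1..b}"
    have "k + int j - int i' = int (N i' j)" using ij by (simp add: k N_def of_nat_diff)
    then show "u i' * v j * fd_cov d (k + int j - int i') = u i' * v j * (\<kappa> * Beta (real (N i' j) + d) (1 - 2 * d))"
      unfolding \<kappa>_def using fd_cov_Beta[OF d i] by simp
  qed
  also have "\<dots> = \<kappa> * (\<Sum>i=1..b. \<Sum>j=1..b. u i * v j * Beta (real (N i j) + d) (1 - 2 * d))"
    by (simp add: sum_distrib_left mult_ac)
  also have "\<bar>\<dots>\<bar> = \<kappa> * \<bar>\<Sum>i=1..b. \<Sum>j=1..b. u i * v j * Beta (real (N i j) + d) (1 - 2 * d)\<bar>"
    using \<kappa> by (simp add: abs_mult)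
  also have "\<dots> \<le> \<kappa> * (B * Beta (real n + d) (1 - 2 * d))"
  proof (intro mult_left_mono \<kappa>)
    have "\<bar>integral {0..1} G\<bar> \<le> integral {0..1} R"
      using integral_norm_bound_integral[of G "{0..1}" R] GR Gint Rint by auto
    then show "\<bar>\<Sum>i=1..b. \<Sum>j=1..b. u i * v j * Beta (real (N i j) + d) (1 - 2 * d)\<bar> \<le> B * Beta (real n + d) (1 - 2 * d)"
      unfolding integral_unique[OF Gint] integral_unique[OF Rint] .
  qed
  also have "\<dots> = B * fd_cov d (int n)"
    using fd_cov_Beta[OF d i, of n] by (simp add: \<kappa>_def)
  finally show ?thesis by (simp add: B_def mult_ac)
qed

section \<open>Canonical correlations of distant blocks\<close>

lemma covariance_linear_combination:
  assumes st: "second_order_stationary M Z"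
  shows "covariance M (\<lambda>\<omega>. \<Sum>i=1..b. u i * Z (k + int i) \<omega>) (\<lambda>\<omega>. \<Sum>j=1..b. v j * Z (l + int j) \<omega>) =
    (\<Sum>i=1..b. \<Sum>j=1..b. u i * v j * autocovariance M Z (l - k + int j - int i))"
proof -
  interpret prob_space M using st by (simp add: second_order_stationary_def)
  have m [measurable]: "Z n \<in> borel_measurable M" for n using st by (simp add: second_order_stationary_def)
  have sq: "integrable M (\<lambda>\<omega>. (Z n \<omega>)\<^sup>2)" for n using st by (simp add: second_order_stationary_def)
  have i1: "integrable M (Z n)" for n by (rule square_integrable_imp_integrable[OF m sq])
  have i2: "integrable M (\<lambda>\<omega>. Z n \<omega> * Z n' \<omega>)" for n n'
  proof (rule Bochner_Integration.integrable_bound[of M "\<lambda>\<omega>. (Z n \<omega>)\<^sup>2 + (Z n' \<omega>)\<^sup>2"])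
    show "AE \<omega> in M. norm (Z n \<omega> * Z n' \<omega>) \<le> norm ((Z n \<omega>)\<^sup>2 + (Z n' \<omega>)\<^sup>2)"
    proof (rule AE_I2)
      fix \<omega>
      have "2 * \<bar>Z n \<omega> * Z n' \<omega>\<bar> \<le> (Z n \<omega>)\<^sup>2 + (Z n' \<omega>)\<^sup>2" using weighted_am_gm[of 1 "Z n \<omega>" "Z n' \<omega>"] by simp
      then show "norm (Z n \<omega> * Z n' \<omega>) \<le> norm ((Z n \<omega>)\<^sup>2 + (Z n' \<omega>)\<^sup>2)" by simp
    qed
  qed (use sq in auto)
  define Y where "Y n \<omega> = Z n \<omega> - (LINT \<xi>|M. Z n \<xi>)" for n \<omega>
  have iY: "integrable M (\<lambda>\<omega>. Y n \<omega> * Y n' \<omega>)" for n n'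
    unfolding Y_def left_diff_distrib right_diff_distrib
    by (intro Bochner_Integration.integrable_diff i2 i1 integrable_mult_right integrable_mult_left integrable_const)
  have cen: "(\<Sum>i=1..b. w i * Z (l + int i) \<omega>) - (LINT \<xi>|M. (\<Sum>i=1..b. w i * Z (l + int i) \<xi>)) = (\<Sum>i=1..b. w i * Y (l + int i) \<omega>)" for w :: "nat \<Rightarrow> real" and l \<omega>
    by (simp add: Bochner_Integration.integral_sum i1 Y_def right_diff_distrib sum_subtractf)
  have cov: "(LINT \<omega>|M. Y (k + int i) \<omega> * Y (l + int j) \<omega>) = autocovariance M Z (l - k + int j - int i)" for i j
  proof -
    have "(LINT \<omega>|M. Y (k + int i) \<omega> * Y (l + int j) \<omega>) =
        covariance M (Z ((k + int i) + (l - k + int j - int i))) (Z (k + int i))"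
      unfolding covariance_def Y_def by (simp add: mult.commute)
    also have "\<dots> = covariance M (Z (l - k + int j - int i)) (Z 0)"
      using st by (simp only: second_order_stationary_def)
    finally show ?thesis by (simp add: autocovariance_def)
  qed
  have "covariance M (\<lambda>\<omega>. \<Sum>i=1..b. u i * Z (k + int i) \<omega>) (\<lambda>\<omega>. \<Sum>j=1..b. v j * Z (l + int j) \<omega>) =
     (LINT \<omega>|M. (\<Sum>i=1..b. \<Sum>j=1..b. u i * v j * (Y (k + int i) \<omega> * Y (l + int j) \<omega>)))"
    unfolding covariance_def cen sum_product by (simp add: mult_ac)
  also have "\<dots> = (\<Sum>i=1..b. \<Sum>j=1..b. u i * v j * (LINT \<omega>|M. Y (k + int i) \<omega> * Y (l + int j) \<omega>))"
    by (simp only: Bochner_Integration.integral_sum Bochner_Integration.integrable_sum integrable_mult_right iY integral_mult_right_zero)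
  finally show ?thesis unfolding cov .
qed

lemma correlation_blocks:
  fixes b :: nat
  assumes st: "second_order_stationary M Z" and sd: "spectral_density f (autocovariance M Z)"
  defines "Q \<equiv> \<lambda>k u v. LINT t|lborel. circle t * f t * cross_form b k u v t"
  shows "correlation M (\<lambda>\<omega>. \<Sum>j=1..b. u j * Z (int j) \<omega>) (\<lambda>\<omega>. \<Sum>j=1..b. v j * Z (int (k + j)) \<omega>) =
    Q (int k) u v / (sqrt (Q 0 u u) * sqrt (Q 0 v v))"
proof -
  have *: "covariance M (\<lambda>\<omega>. \<Sum>i=1..b. u i * Z (k + int i) \<omega>) (\<lambda>\<omega>. \<Sum>j=1..b. v j * Z (l + int j) \<omega>) = Q (l - k) u v" for k l u v
    unfolding covariance_linear_combination[OF st] Q_def integral_cross_form(1)[OF spectral_densityD(1)[OF sd]]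
      spectral_densityD(2)[OF sd] ..
  from *[of u 0 v "int k"] *[of u 0 u 0] *[of v "int k" v "int k"]
  show ?thesis by (simp add: correlation_def)
qed

text \<open>Cauchy--Schwarz with the absolute value inside the integral, so that a uniformly small
  factor can be pulled out of the density. With the full density as weight it also yields the bound
  1 for correlations.\<close>

lemma integral_abs_cross_form_le:
  assumes w: "integrable lborel w" "\<And>t. 0 \<le> w t"
  shows "(LINT t|lborel. w t * \<bar>cross_form b k u v t\<bar>) \<le>
    sqrt (LINT t|lborel. w t * cross_form b 0 u u t) * sqrt (LINT t|lborel. w t * cross_form b 0 v v t)"
proof -
  let ?Q = "\<lambda>u. LINT t|lborel. w t * cross_form b 0 u u t"
  have i: "integrable lborel (\<lambda>t. w t * cross_form b k u v t)" for k u v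
    by (rule integral_cross_form(2)[OF w(1)])
  have "integrable lborel (\<lambda>t. \<bar>w t * cross_form b k u v t\<bar>)" by (intro integrable_abs i)
  then have ia: "integrable lborel (\<lambda>t. w t * \<bar>cross_form b k u v t\<bar>)" using w(2) by (simp add: abs_mult)
  have Q0: "?Q u \<ge> 0" for u
    by (intro integral_nonneg_AE AE_I2 mult_nonneg_nonneg cross_form_diag_nonneg w)
  have "2 * (LINT t|lborel. w t * \<bar>cross_form b k u v t\<bar>) \<le> 2 * sqrt (?Q u) * sqrt (?Q v)"
  proof (rule le_geometric_mean[OF Q0 Q0])
    fix s :: real assume s: "s > 0"
    have "2 * (LINT t|lborel. w t * \<bar>cross_form b k u v t\<bar>) = (LINT t|lborel. 2 * (w t * \<bar>cross_form b k u v t\<bar>))" by simp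
    also have "\<dots> \<le> (LINT t|lborel. s * (w t * cross_form b 0 u u t) + (1 / s) * (w t * cross_form b 0 v v t))"
    proof (intro integral_mono Bochner_Integration.integrable_add integrable_mult_right i ia)
      fix t
      have "w t * (2 * \<bar>cross_form b k u v t\<bar>) \<le> w t * (s * cross_form b 0 u u t + cross_form b 0 v v t / s)"
        by (intro mult_left_mono cross_form_le s w)
      then show "2 * (w t * \<bar>cross_form b k u v t\<bar>) \<le> s * (w t * cross_form b 0 u u t) + (1 / s) * (w t * cross_form b 0 v v t)"
        by (simp add: algebra_simps)
    qed
    also have "\<dots> = s * ?Q u + ?Q v / s"
      by (subst Bochner_Integration.integral_add) (auto intro!: i)
    finally show "2 * (LINT t|lborel. w t * \<bar>cross_form b k u v t\<bar>) \<le> s * ?Q u + ?Q v / s" .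
  qed
  then show ?thesis by simp
qed

text \<open>The distance hypothesis makes the index \<open>n\<close> of
  \<open>fd_cross_form_bound\<close> at least \<open>m * b\<close>; the powers of \<open>b\<close>
  then cancel and the bound depends on \<open>m\<close> alone.\<close>

lemma fd_cross_form_far:
  assumes d: "0 < d" "d < 1/2" and i: "integrable lborel (\<lambda>t. circle t * fd d t)"
    and b: "b \<ge> 1" and m: "m \<ge> 1" and k: "k \<ge> int ((m + 3) * b + 1)"
  defines "Q \<equiv> \<lambda>w. LINT t|lborel. circle t * fd d t * cross_form b 0 w w t"
  shows "\<bar>LINT t|lborel. circle t * fd d t * cross_form b k u v t\<bar> \<le>
    16 * fd_cov d 0 * real m powr (2 * d - 1) * (sqrt (Q u) * sqrt (Q v))"
proof -
  define n where "n = nat (k - 3 * int b - 1)"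
  have k2: "int (m * b) \<le> k - 3 * int b - 1" using k by (simp add: algebra_simps)
  moreover have "0 \<le> int (m * b)" by simp
  ultimately have "0 \<le> k - 3 * int b - 1" by linarith
  then have kn: "k = int n + 3 * int b + 1" unfolding n_def by simp
  have "int (m * b) \<le> int n" using k2 kn by simp
  then have mb: "real m * real b \<le> real n" by (metis of_nat_le_iff of_nat_mult)
  have Q0: "Q w \<ge> 0" for w unfolding Q_def
    by (intro integral_nonneg_AE AE_I2 mult_nonneg_nonneg cross_form_diag_nonneg fd_nonneg) auto
  have "fd_cov d (int n) \<le> fd_cov d 0 * (real n + 1 - d) powr (2 * d - 1)" by (rule fd_cov_decay[OF d i])
  also have "\<dots> \<le> fd_cov d 0 * (real m * real b) powr (2 * d - 1)"
    using mb d b m by (intro mult_left_mono powr_mono2' fd_cov_0_nonneg) auto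
  finally have g: "fd_cov d (int n) \<le> fd_cov d 0 * (real m * real b) powr (2 * d - 1)" .
  have "\<bar>LINT t|lborel. circle t * fd d t * cross_form b k u v t\<bar> \<le>
      16 * real b powr (1 - 2 * d) * fd_cov d (int n) * (sqrt (Q u) * sqrt (Q v))"
    unfolding Q_def by (rule fd_cross_form_bound[OF d i b kn])
  also have "\<dots> \<le> 16 * real b powr (1 - 2 * d) * (fd_cov d 0 * (real m * real b) powr (2 * d - 1)) * (sqrt (Q u) * sqrt (Q v))"
    using Q0 by (intro mult_right_mono mult_left_mono g) auto
  also have "\<dots> = 16 * fd_cov d 0 * real m powr (2 * d - 1) * (real b powr (1 - 2 * d) * real b powr (2 * d - 1)) * (sqrt (Q u) * sqrt (Q v))"
    by (simp add: powr_mult)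
  also have "real b powr (1 - 2 * d) * real b powr (2 * d - 1) = 1"
    using b by (subst powr_add[symmetric]) simp
  finally show ?thesis by simp
qed

lemma cos_times_cross_form:
  "cos (real m * t) * cross_form b k u v t = (cross_form b (k + int m) u v t + cross_form b (k - int m) u v t) / 2"
proof -
  have "cos (of_int (k + int m + int j - int i) * t) + cos (of_int (k - int m + int j - int i) * t) =
    2 * (cos (real m * t) * cos (of_int (k + int j - int i) * t))" for i j
  proof -
    have 1: "cos (of_int (k + int m + int j - int i) * t) = cos (of_int (k + int j - int i) * t) * cos (real m * t) - sin (of_int (k + int j - int i) * t) * sin (real m * t)"
      by (subst cos_add[symmetric]) (simp add: algebra_simps)
    have 2: "cos (of_int (k - int m + int j - int i) * t) = cos (of_int (k + int j - int i) * t) * cos (real m * t) + sin (of_int (k + int j - int i) * t) * sin (real m * t)"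
      by (subst cos_diff[symmetric]) (simp add: algebra_simps)
    show ?thesis unfolding 1 2 by (simp add: algebra_simps)
  qed
  then have "cross_form b (k + int m) u v t + cross_form b (k - int m) u v t = 2 * (cos (real m * t) * cross_form b k u v t)"
    unfolding cross_form_def sum.distrib[symmetric] distrib_left[symmetric] by (simp add: sum_distrib_left mult_ac)
  then show ?thesis by simp
qed

lemma correlation_far:
  assumes d: "0 < d" "d < 1/2" and w: "integrable lborel (\<lambda>t. circle t * (fd d t * f0 t))"
    and c: "0 < c" "\<And>t. t \<in> {-pi<..pi} \<Longrightarrow> c \<le> f0 t"
    and fourier: "\<And>e. e > 0 \<Longrightarrow> \<exists>N a. AE t in lborel. t \<in> {-pi<..pi} \<longrightarrow> \<bar>f0 t - (\<Sum>m<N. a m * cos (real m * t))\<bar> \<le> e"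
    and \<eta>: "\<eta> > 0"
  defines "Q \<equiv> \<lambda>b k u v. LINT t|lborel. circle t * (fd d t * f0 t) * cross_form b k u v t"
  shows "\<exists>C::nat. \<forall>b\<ge>1. \<forall>k\<ge>C * b + C. \<forall>u v. \<bar>Q b (int k) u v\<bar> \<le> \<eta> * (sqrt (Q b 0 u u) * sqrt (Q b 0 v v))"
proof -
  \<comment> \<open>Dividing by the lower bound \<open>c\<close> of \<open>f0\<close> dominates
    \<open>fd d\<close> by the integrable product.\<close>
  have i: "integrable lborel (\<lambda>t. circle t * fd d t)"
  proof (rule Bochner_Integration.integrable_bound[of _ "\<lambda>t. (1 / c) * (circle t * (fd d t * f0 t))"])
    show "AE t in lborel. norm (circle t * fd d t) \<le> norm (1 / c * (circle t * (fd d t * f0 t)))"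
    proof (rule AE_I2)
      fix t
      show "norm (circle t * fd d t) \<le> norm (1 / c * (circle t * (fd d t * f0 t)))"
      proof (cases "t \<in> {-pi<..pi}")
        case True
        have "fd d t * 1 \<le> fd d t * (f0 t / c)"
          using c(1) c(2)[OF True] by (intro mult_left_mono fd_nonneg) auto
        moreover have "f0 t \<ge> 0" using c(1) c(2)[OF True] by simp
        ultimately show ?thesis using True c(1) fd_nonneg[of d t] by (simp add: abs_mult)
      qed simp
    qed
  qed (use w in auto)
  define P where "P b u = (LINT t|lborel. circle t * fd d t * cross_form b 0 u u t)" for b u
  have P0: "P b u \<ge> 0" for b u unfolding P_def
    by (intro integral_nonneg_AE AE_I2 mult_nonneg_nonneg cross_form_diag_nonneg fd_nonneg) auto
  have PQ: "c * P b u \<le> Q b 0 u u" for b u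
  proof -
    have "c * P b u = (LINT t|lborel. c * (circle t * fd d t * cross_form b 0 u u t))" by (simp add: P_def)
    also have "\<dots> \<le> Q b 0 u u"
      unfolding Q_def
    proof (intro integral_mono integrable_mult_right integral_cross_form(2) i w)
      fix t
      show "c * (circle t * fd d t * cross_form b 0 u u t) \<le> circle t * (fd d t * f0 t) * cross_form b 0 u u t"
      proof (cases "t \<in> {-pi<..pi}")
        case True
        have "c * (fd d t * cross_form b 0 u u t) \<le> f0 t * (fd d t * cross_form b 0 u u t)"
          by (intro mult_right_mono c(2)[OF True] mult_nonneg_nonneg fd_nonneg cross_form_diag_nonneg)
        then show ?thesis using True by (simp add: mult_ac)
      qed simp
    qed
    finally show ?thesis .
  qed
  \<comment> \<open>Half of \<eta> is for the uniform error and half for the polynomial. The factor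
    \<open>c\<close> pays for passing from the variances \<open>P\<close> under \<open>fd\<close> to
    the actual ones, by \<open>PQ\<close>.\<close>
  obtain N a where ae: "AE t in lborel. t \<in> {-pi<..pi} \<longrightarrow> \<bar>f0 t - (\<Sum>m<N. a m * cos (real m * t))\<bar> \<le> c * \<eta> / 2"
    using fourier[of "c * \<eta> / 2"] c \<eta> by auto
  define A where "A = (\<Sum>m<N. \<bar>a m\<bar>)"
  have A: "A \<ge> 0" by (simp add: A_def sum_nonneg)
  have "((\<lambda>m. A * (16 * fd_cov d 0 * real m powr (2 * d - 1))) \<longlongrightarrow> A * (16 * fd_cov d 0 * 0)) sequentially"
    using d by (intro tendsto_intros tendsto_neg_powr filterlim_real_sequentially) auto
  then have "eventually (\<lambda>m. A * (16 * fd_cov d 0 * real m powr (2 * d - 1)) < c * \<eta> / 2) sequentially"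
    using c \<eta> by (intro order_tendstoD(2)[where y="A * (16 * fd_cov d 0 * 0)"]) auto
  then obtain m where m: "m \<ge> 1" and mb: "A * (16 * fd_cov d 0 * real m powr (2 * d - 1)) < c * \<eta> / 2"
    using eventually_ge_at_top[of "1::nat"] by (metis (no_types, lifting) eventually_sequentially nle_le)
  \<comment> \<open>The multiple of \<open>b\<close> covers the distance \<open>(m + 3) * b\<close>
    required by \<open>fd_cross_form_far\<close>; the constant covers its 1 and the shifts by
    frequencies below \<open>N\<close>.\<close>
  define C where "C = m + 3 + N + 1"
  show ?thesis
  proof (intro exI[of _ C] allI impI)
    fix b k :: nat and u v :: "nat \<Rightarrow> real" assume b: "b \<ge> 1" and k: "C * b + C \<le> k"
    define S where "S = sqrt (P b u) * sqrt (P b v)"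
    have S0: "S \<ge> 0" by (simp add: S_def P0)
    have far: "\<bar>LINT t|lborel. circle t * fd d t * cross_form b k' u v t\<bar> \<le> 16 * fd_cov d 0 * real m powr (2 * d - 1) * S"
      if k': "k' \<ge> int k - int N" for k'
      unfolding S_def P_def
    proof (rule fd_cross_form_far[OF d i b m])
      have "(m + 3) * b + 1 + N \<le> k" using k by (simp add: C_def algebra_simps)
      then show "int ((m + 3) * b + 1) \<le> k'" using k' by linarith
    qed
    have ic: "integrable lborel (\<lambda>t. circle t * fd d t * cross_form b k' u v t)" for k'
      by (rule integral_cross_form(2)[OF i])
    have cosK: "\<bar>LINT t|lborel. circle t * fd d t * (cos (real l * t) * cross_form b (int k) u v t)\<bar> \<le> 16 * fd_cov d 0 * real m powr (2 * d - 1) * S"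
      "integrable lborel (\<lambda>t. circle t * fd d t * (cos (real l * t) * cross_form b (int k) u v t))"
      if l: "l < N" for l
    proof -
      have eq: "circle t * fd d t * (cos (real l * t) * cross_form b (int k) u v t) =
        (circle t * fd d t * cross_form b (int k + int l) u v t + circle t * fd d t * cross_form b (int k - int l) u v t) / 2" for t
        unfolding cos_times_cross_form by (simp add: algebra_simps)
      show "integrable lborel (\<lambda>t. circle t * fd d t * (cos (real l * t) * cross_form b (int k) u v t))"
        unfolding eq by (intro integrable_divide_zero Bochner_Integration.integrable_add ic)
      have mean: "\<bar>(x + y) / 2\<bar> \<le> e" if "\<bar>x\<bar> \<le> e" "\<bar>y\<bar> \<le> e" for x y e :: real
        using that by (auto simp: abs_le_iff)
      have "(LINT t|lborel. circle t * fd d t * (cos (real l * t) * cross_form b (int k) u v t)) =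
         ((LINT t|lborel. circle t * fd d t * cross_form b (int k + int l) u v t) + (LINT t|lborel. circle t * fd d t * cross_form b (int k - int l) u v t)) / 2"
        unfolding eq using ic by simp
      then show "\<bar>LINT t|lborel. circle t * fd d t * (cos (real l * t) * cross_form b (int k) u v t)\<bar> \<le> 16 * fd_cov d 0 * real m powr (2 * d - 1) * S"
        using l by (simp only:) (intro mean far, auto)
    qed
    define r where "r t = f0 t - (\<Sum>m<N. a m * cos (real m * t))" for t
    have split: "circle t * (fd d t * f0 t) * cross_form b (int k) u v t =
      (\<Sum>l<N. a l * (circle t * fd d t * (cos (real l * t) * cross_form b (int k) u v t)))
       + circle t * fd d t * r t * cross_form b (int k) u v t" for t
    proof -
      have f0: "f0 t = (\<Sum>l<N. a l * cos (real l * t)) + r t" by (simp add: r_def)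
      show ?thesis unfolding f0 by (simp add: sum_distrib_left sum_distrib_right distrib_left distrib_right mult_ac)
    qed
    have iw: "integrable lborel (\<lambda>t. circle t * (fd d t * f0 t) * cross_form b (int k) u v t)"
      by (rule integral_cross_form(2)[OF w])
    have isum: "integrable lborel (\<lambda>t. \<Sum>l<N. a l * (circle t * fd d t * (cos (real l * t) * cross_form b (int k) u v t)))"
      using cosK by (intro Bochner_Integration.integrable_sum integrable_mult_right) auto
    \<comment> \<open>Obtained by subtraction, since \<open>r\<close> is known to be bounded only
      almost everywhere.\<close>
    have ir: "integrable lborel (\<lambda>t. circle t * fd d t * r t * cross_form b (int k) u v t)"
      using Bochner_Integration.integrable_diff[OF iw isum] unfolding split by simp
    have "\<bar>LINT t|lborel. circle t * fd d t * r t * cross_form b (int k) u v t\<bar> \<le>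
       (LINT t|lborel. \<bar>circle t * fd d t * r t * cross_form b (int k) u v t\<bar>)"
      by (rule integral_abs_bound)
    also have "\<dots> \<le> (LINT t|lborel. c * \<eta> / 2 * (circle t * fd d t * \<bar>cross_form b (int k) u v t\<bar>))"
    proof (rule integral_mono_AE)
      have "integrable lborel (\<lambda>t. \<bar>circle t * fd d t * cross_form b (int k) u v t\<bar>)" by (intro integrable_abs ic)
      then show "integrable lborel (\<lambda>t. c * \<eta> / 2 * (circle t * fd d t * \<bar>cross_form b (int k) u v t\<bar>))"
        by (intro integrable_mult_right) (simp add: abs_mult fd_nonneg)
      show "AE t in lborel. \<bar>circle t * fd d t * r t * cross_form b (int k) u v t\<bar> \<le> c * \<eta> / 2 * (circle t * fd d t * \<bar>cross_form b (int k) u v t\<bar>)"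
        using ae
      proof eventually_elim
        case (elim t)
        show ?case
        proof (cases "t \<in> {-pi<..pi}")
          case True
          then have "\<bar>r t\<bar> \<le> c * \<eta> / 2" using elim by (simp add: r_def)
          then have "\<bar>r t\<bar> * (fd d t * \<bar>cross_form b (int k) u v t\<bar>) \<le> c * \<eta> / 2 * (fd d t * \<bar>cross_form b (int k) u v t\<bar>)"
            by (intro mult_right_mono) (auto simp: fd_nonneg)
          then show ?thesis using True by (simp add: abs_mult fd_nonneg mult_ac)
        qed simp
      qed
    qed (intro integrable_abs ir)
    also have "\<dots> = c * \<eta> / 2 * (LINT t|lborel. circle t * fd d t * \<bar>cross_form b (int k) u v t\<bar>)"
      by (rule integral_mult_right_zero)
    also have "\<dots> \<le> c * \<eta> / 2 * S"
      unfolding S_def P_def using c \<eta>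
      by (intro mult_left_mono integral_abs_cross_form_le i) (auto simp: fd_nonneg)
    finally have rb: "\<bar>LINT t|lborel. circle t * fd d t * r t * cross_form b (int k) u v t\<bar> \<le> c * \<eta> / 2 * S" .
    define I where "I l = (LINT t|lborel. circle t * fd d t * (cos (real l * t) * cross_form b (int k) u v t))" for l
    have "Q b (int k) u v = (\<Sum>l<N. a l * I l) + (LINT t|lborel. circle t * fd d t * r t * cross_form b (int k) u v t)"
      unfolding Q_def split I_def using cosK(2)
      by (subst Bochner_Integration.integral_add[OF isum ir], subst Bochner_Integration.integral_sum) auto
    then have Qle: "\<bar>Q b (int k) u v\<bar> \<le> \<bar>\<Sum>l<N. a l * I l\<bar> + c * \<eta> / 2 * S"
      using rb by linarith
    have "\<bar>\<Sum>l<N. a l * I l\<bar> \<le> (\<Sum>l<N. \<bar>a l\<bar> * (16 * fd_cov d 0 * real m powr (2 * d - 1) * S))"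
    proof (intro order_trans[OF sum_abs] sum_mono)
      fix l assume "l \<in> {..<N}"
      then show "\<bar>a l * I l\<bar> \<le> \<bar>a l\<bar> * (16 * fd_cov d 0 * real m powr (2 * d - 1) * S)"
        unfolding abs_mult[of "a l"] I_def by (intro mult_left_mono cosK(1)) auto
    qed
    also have "\<dots> = A * (16 * fd_cov d 0 * real m powr (2 * d - 1)) * S" by (simp only: A_def sum_distrib_right mult.assoc)
    also have "\<dots> \<le> c * \<eta> / 2 * S" using mb S0 by (intro mult_right_mono) auto
    finally have "\<bar>Q b (int k) u v\<bar> \<le> \<eta> * (c * S)" using Qle by (simp add: algebra_simps)
    also have "c * S = sqrt (c * P b u) * sqrt (c * P b v)" using c by (simp add: S_def real_sqrt_mult)
    also have "\<dots> \<le> sqrt (Q b 0 u u) * sqrt (Q b 0 v v)"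
      using P0 c PQ by (intro mult_mono) (auto intro: order_trans[OF _ PQ])
    finally show "\<bar>Q b (int k) u v\<bar> \<le> \<eta> * (sqrt (Q b 0 u u) * sqrt (Q b 0 v v))"
      using \<eta> by (simp add: mult_left_mono)
  qed
qed

section \<open>From forms to canonical correlations and their sum\<close>

lemma canonical_correlation_abs_le:
  assumes "b \<ge> 1"
    and "\<And>u v. \<bar>correlation M (\<lambda>\<omega>. \<Sum>j=1..b. u j * Z (int j) \<omega>) (\<lambda>\<omega>. \<Sum>j=1..b. v j * Z (int (k + j)) \<omega>)\<bar> \<le> e"
  shows "\<bar>canonical_correlation M Z k b\<bar> \<le> e"
  unfolding canonical_correlation_def
proof (rule cSup_abs_le)
  \<comment> \<open>A bound for a supremum of reals requires a nonempty index set; this is where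
    \<open>b \<ge> 1\<close> enters.\<close>
  have "(\<lambda>_. 1, \<lambda>_. 1) \<in> {u::nat\<Rightarrow>real. \<exists>j\<in>{1..b}. u j \<noteq> 0} \<times> {v::nat\<Rightarrow>real. \<exists>j\<in>{1..b}. v j \<noteq> 0}"
    using assms(1) by auto
  then show "(\<lambda>(u, v). correlation M (\<lambda>\<omega>. \<Sum>j=1..b. u j * Z (int j) \<omega>) (\<lambda>\<omega>. \<Sum>j=1..b. v j * Z (int (k + j)) \<omega>)) `
      ({u. \<exists>j\<in>{1..b}. u j \<noteq> 0} \<times> {v. \<exists>j\<in>{1..b}. v j \<noteq> 0}) \<noteq> {}"
    unfolding image_is_empty ex_in_conv[symmetric] by (rule exI)
qed (use assms(2) in auto)

text \<open>For \<open>y = 0\<close> the quotient is 0 by convention, so blocks of variance zero are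
  covered.\<close>

lemma abs_divide_le_of_le_mult:
  fixes x y e :: real
  assumes "\<bar>x\<bar> \<le> e * y" "y \<ge> 0" "e \<ge> 0"
  shows "\<bar>x / y\<bar> \<le> e"
  using assms by (cases "y = 0") (auto simp: abs_mult divide_le_eq)

theorem theorem3p3:
  fixes M :: "'a measure" and Z :: "int \<Rightarrow> 'a \<Rightarrow> real"
    and d :: real and f0 :: "real \<Rightarrow> real" and \<gamma>0 :: "int \<Rightarrow> real"
    and b :: "nat \<Rightarrow> nat"
  assumes "0 < d" and "d < 1 / 2"
    and "second_order_stationary M Z"
    and "spectral_density (\<lambda>t. fd d t * f0 t) (autocovariance M Z)"
    and "spectral_density f0 \<gamma>0"
    and "(INF t\<in>{-pi<..pi}. f0 t) > 0"
    and "(\<lambda>n. \<bar>\<gamma>0 n\<bar>) summable_on UNIV"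
    and "(\<lambda>n. \<gamma>0 (int n)) \<in> O(\<lambda>n. 1 / real n)"
    and "\<And>n. n \<ge> 1 \<Longrightarrow> b n \<ge> 1"
    and "(\<lambda>n. real (b n)) \<in> o(\<lambda>n. real n)"
  shows "(\<lambda>n. \<Sum>k=1..n. canonical_correlation M Z k (b n)) \<in> o(\<lambda>n. real n)"
proof (rule landau_o.smallI)
  fix \<epsilon> :: real assume \<epsilon>: "\<epsilon> > 0"
  define Q where "Q b k u v = (LINT t|lborel. circle t * (fd d t * f0 t) * cross_form b k u v t)" for b k u v
  note w = spectral_densityD(1)[OF assms(4)]
  have w0: "0 \<le> circle t * (fd d t * f0 t)" for t
    using spectral_densityD(4)[OF assms(4), of t] by (auto simp: indicator_def)
  have Q0: "Q b 0 u u \<ge> 0" for b u unfolding Q_def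
    by (intro integral_nonneg_AE AE_I2 mult_nonneg_nonneg cross_form_diag_nonneg w0)
  have corr: "correlation M (\<lambda>\<omega>. \<Sum>j=1..b. u j * Z (int j) \<omega>) (\<lambda>\<omega>. \<Sum>j=1..b. v j * Z (int (k + j)) \<omega>) =
    Q b (int k) u v / (sqrt (Q b 0 u u) * sqrt (Q b 0 v v))" for b k u v
    unfolding Q_def by (rule correlation_blocks[OF assms(3,4)])
  have cc: "\<bar>canonical_correlation M Z k b\<bar> \<le> e"
    if "b \<ge> 1" "e \<ge> 0" "\<And>u v. \<bar>Q b (int k) u v\<bar> \<le> e * (sqrt (Q b 0 u u) * sqrt (Q b 0 v v))" for b k e
  proof (rule canonical_correlation_abs_le[OF that(1)])
    fix u v
    show "\<bar>correlation M (\<lambda>\<omega>. \<Sum>j=1..b. u j * Z (int j) \<omega>) (\<lambda>\<omega>. \<Sum>j=1..b. v j * Z (int (k + j)) \<omega>)\<bar> \<le> e"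
      unfolding corr by (rule abs_divide_le_of_le_mult[OF that(3) _ that(2)]) (simp add: Q0)
  qed
  have cc1: "\<bar>canonical_correlation M Z k b\<bar> \<le> 1" if "b \<ge> 1" for k b
  proof (rule cc[OF that])
    fix u v
    have "\<bar>Q b (int k) u v\<bar> \<le> (LINT t|lborel. \<bar>circle t * (fd d t * f0 t) * cross_form b (int k) u v t\<bar>)"
      unfolding Q_def by (rule integral_abs_bound)
    also have "\<dots> = (LINT t|lborel. circle t * (fd d t * f0 t) * \<bar>cross_form b (int k) u v t\<bar>)"
      by (intro Bochner_Integration.integral_cong refl) (simp only: abs_mult[of "circle t * (fd d t * f0 t)" for t] abs_of_nonneg[OF w0])
    also have "\<dots> \<le> 1 * (sqrt (Q b 0 u u) * sqrt (Q b 0 v v))"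
      unfolding Q_def mult_1_left by (rule integral_abs_cross_form_le[OF w w0])
    finally show "\<bar>Q b (int k) u v\<bar> \<le> 1 * (sqrt (Q b 0 u u) * sqrt (Q b 0 v v))" .
  qed simp
  \<comment> \<open>An infimum of reals is a lower bound only for sets bounded below; nonnegativity
    of the density \<open>f0\<close> provides this.\<close>
  have f0c: "(INF t\<in>{-pi<..pi}. f0 t) \<le> f0 t" if "t \<in> {-pi<..pi}" for t
  proof (rule cINF_lower[OF _ that])
    show "bdd_below (f0 ` {-pi<..pi})"
      using spectral_densityD(4)[OF assms(5)] by (intro bdd_belowI2[of _ 0]) auto
  qed
  \<comment> \<open>One third each for the correlations with \<open>k \<ge> C * b n + C\<close>, for
    the \<open>C * b n\<close> near terms and for the remaining \<open>C\<close>.\<close>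
  define \<eta> where "\<eta> = \<epsilon> / 3"
  have \<eta>: "\<eta> > 0" using \<epsilon> by (simp add: \<eta>_def)
  obtain C :: nat where C: "\<And>b k u v. b \<ge> 1 \<Longrightarrow> k \<ge> C * b + C \<Longrightarrow> \<bar>Q b (int k) u v\<bar> \<le> \<eta> * (sqrt (Q b 0 u u) * sqrt (Q b 0 v v))"
    using correlation_far[OF assms(1,2) w assms(6) f0c spectral_density_uniform_approx[OF assms(5,7)] \<eta>]
    unfolding Q_def by blast
  \<comment> \<open>The \<open>+ 1\<close> keeps the quotient meaningful when
    \<open>C = 0\<close>.\<close>
  have "eventually (\<lambda>n. norm (real (b n)) \<le> \<eta> / (real C + 1) * norm (real n)) at_top"
    using assms(10) \<eta> by (intro landau_o.smallD) auto
  moreover have "eventually (\<lambda>n. real C / \<eta> \<le> real n) at_top"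
    using filterlim_real_sequentially by (simp add: filterlim_at_top)
  moreover have "eventually (\<lambda>n::nat. n \<ge> 1) at_top" by (rule eventually_ge_at_top)
  ultimately show "\<forall>\<^sub>F n in at_top. norm (\<Sum>k=1..n. canonical_correlation M Z k (b n)) \<le> \<epsilon> * norm (real n)"
  proof eventually_elim
    case (elim n)
    have bn: "b n \<ge> 1" using assms(9) elim by simp
    define T where "T = C * b n + C"
    have "\<bar>\<Sum>k=1..n. canonical_correlation M Z k (b n)\<bar> \<le> (\<Sum>k=1..n. \<bar>canonical_correlation M Z k (b n)\<bar>)"
      by (rule sum_abs)
    also have "\<dots> \<le> (\<Sum>k=1..n. \<eta> + (if k \<in> {..<T} then 1 else 0))"
    proof (rule sum_mono)
      fix k
      show "\<bar>canonical_correlation M Z k (b n)\<bar> \<le> \<eta> + (if k \<in> {..<T} then 1 else 0)"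
      proof (cases "k < T")
        case True
        then show ?thesis using cc1[OF bn, of k] \<eta> by simp
      next
        case False
        then have "\<bar>canonical_correlation M Z k (b n)\<bar> \<le> \<eta>"
          using \<eta> C[OF bn] by (intro cc[OF bn]) (auto simp: T_def)
        then show ?thesis using False by simp
      qed
    qed
    also have "\<dots> = \<eta> * real n + real (card ({1..n} \<inter> {..<T}))"
      by (simp add: sum.distrib sum.If_cases lessThan_def)
    also have "real (card ({1..n} \<inter> {..<T})) \<le> real T"
      using card_mono[of "{..<T}" "{1..n} \<inter> {..<T}"] by simp
    also have "real T = real C * real (b n) + real C" by (simp add: T_def)
    also have "real C * real (b n) \<le> (real C + 1) * (\<eta> / (real C + 1) * real n)"
      using elim by (intro mult_mono) auto
    also have "(real C + 1) * (\<eta> / (real C + 1) * real n) = \<eta> * real n" by simp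
    also have "real C \<le> \<eta> * real n" using elim \<eta> by (simp add: field_simps)
    finally have "\<bar>\<Sum>k=1..n. canonical_correlation M Z k (b n)\<bar> \<le> \<eta> * real n + (\<eta> * real n + \<eta> * real n)" by simp
    then show ?case by (simp add: \<eta>_def)
  qed
qed

end
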